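(* For each positive integer $N$ there exists a Sidon set $S_N\subset[N]$ such that $|S_N|\geq\frac{1}{\sqrt2}N^{1/2}(1+o(1))$ as $N\to\infty$, and such that there are no $x_1,x_2,x_3,x_4,x_5\in S_N$ with $x_1+x_2+x_3+x_4=x_5$.
   Context: $[N]=\{1,2,\dots,N\}$. A set $S\subset\mathbb{Z}$ is Sidon if every non-zero integer $x$ has at most one representation $x=s_1-s_2$ with $s_1,s_2\in S$. The variables $x_1,\dots,x_5$ are not required to be distinct. *)

theory Defs
  imports Complex_Main "HOL-Library.Landau_Symbols"
begin

(* Representations are counted as ordered pairs (s1, s2). *)
definition sidon :: "int set \<Rightarrow> bool" where
  "sidon S \<longleftrightarrow>
    (\<forall>x. x \<noteq> 0 \<longrightarrow> (\<exists>\<^sub>\<le>\<^sub>1 p. p \<in> S \<times> S \<and> x = fst p - snd p))"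

end

theory Submission
  imports
    Defs
    "HOL-Complex_Analysis.Complex_Analysis"
    "HOL-Number_Theory.Number_Theory"
    "HOL-Real_Asymp.Real_Asymp"
begin

text \<open>
  A dense Sidon set in \<open>[N/2]\<close> is stretched by \<open>x \<mapsto> 2x - 1\<close>: the image consists of odd numbers, so
  a sum of four of its elements is even and lies outside it. For a prime \<open>p\<close>, Ruzsa's construction
  gives a Sidon set of size \<open>p - 1\<close> in \<open>[p (p - 1)]\<close>, so the asymptotics require a prime in
  \<open>[(1 - \<epsilon>) x, x]\<close> for every \<open>\<epsilon> > 0\<close> and all large \<open>x\<close>.

  Such primes come from the Wiener--Ikehara argument. Since \<open>\<zeta>\<close> has no zeros on \<open>Re s = 1\<close>, the
  Dirichlet series of \<open>\<Lambda>(n) - 1\<close> continues holomorphically across this line. Integrating it against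
  a Fejer kernel and applying the Riemann--Lebesgue lemma shows that the averages of
  \<open>\<Lambda>(n)/n\<close> and of \<open>1/n\<close> over \<open>ln n\<close> near \<open>y\<close> agree in the limit \<open>y \<rightarrow> \<infinity>\<close>. A kernel of small
  width bounds the average of \<open>\<Lambda>(n)/n\<close> over a short window from below, and proper prime
  powers in the window contribute a negligible amount.
\<close>

section \<open>The regularised zeta function\<close>

text \<open>The constant 1 / sqrt 2 is the price of parity: the set before stretching has only half
  of \<open>[N]\<close> at its disposal. Keeping exactly this constant rules out Bertrand-type gaps,
  since a prime too small by a fixed factor loses that factor in the size of the set. Finding one
  prime per window asks only for a positive lower bound of the window sum, so no full Tauberian
  theorem and no sharp constant is pursued. The coefficients \<open>mangoldt n - 1\<close> are used
  because both Dirichlet series have the same pole at 1: after subtraction the integrand stays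
  continuous up to the line, and sums of \<open>1 / real n\<close> over windows are estimated by
  counting. The obstacle is the slow decay of the kernel: the mass outside a window must be shown
  small before the mass inside can be called positive. Hence an upper bound for window sums of
  \<open>mangoldt n / real n\<close>, uniform in the position, is proved with a kernel of fixed
  width before the kernel is narrowed.\<close>

lemma summable_nat_powr:
  fixes a :: real
  assumes "a > 1"
  shows "summable (\<lambda>n. real n powr (-a))"
  using assms summable_real_powr_iff[of "-a"] by simp

lemma summable_ln_nat_powr:
  fixes a :: real
  assumes "a > 1"
  shows "summable (\<lambda>n. ln (real n) * real n powr (-a))"
proof (rule summable_comparison_test)
  \<comment> \<open>Half of the excess of \<open>a\<close> over 1 pays for the logarithm; the other
    half keeps the exponent below -1.\<close>
  define e where "e = (a - 1) / 2"
  have e: "e > 0" using assms by (simp add: e_def)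
  show "summable (\<lambda>n. (1 / e) * real n powr (-((a + 1) / 2)))"
    using assms by (intro summable_mult summable_nat_powr) auto
  have "norm (ln (real n) * real n powr (-a)) \<le> (1 / e) * real n powr (-((a + 1) / 2))" for n
  proof (cases "n = 0")
    case False
    then have "ln (real n) * real n powr (-a) \<le> (real n powr e / e) * real n powr (-a)"
      using e by (intro mult_right_mono ln_powr_bound) auto
    also have "\<dots> = (1 / e) * real n powr (e - a)"
      by (simp flip: powr_add)
    also have "e - a = -((a + 1) / 2)" by (simp add: e_def field_simps)
    finally show ?thesis using False by (simp add: abs_mult)
  qed auto
  then show "\<exists>N. \<forall>n\<ge>N. norm (ln (real n) * real n powr (-a)) \<le> (1 / e) * real n powr (-((a + 1) / 2))"
    by blast
qed

lemma norm_nat_powr [simp]: "norm (of_nat n powr s :: complex) = real n powr Re s"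
  by (simp add: norm_powr_real_powr)

text \<open>Absolute convergence allows the double series to be rearranged along the fibres
  \<open>d * k = n\<close>. Vanishing at index 0 discards the pairs with a zero coordinate, which
  would form an infinite fibre over 0.\<close>

lemma sums_dirichlet_product:
  fixes f g h :: "nat \<Rightarrow> complex"
  assumes f: "summable (\<lambda>n. norm (f n))" and g: "summable (\<lambda>n. norm (g n))"
    and f0: "f 0 = 0" and g0: "g 0 = 0" and h0: "h 0 = 0"
    and h: "\<And>n. n > 0 \<Longrightarrow> h n = (\<Sum>d | d dvd n. f d * g (n div d))"
  shows "h sums ((\<Sum>n. f n) * (\<Sum>n. g n))"
proof -
  let ?A = "\<Sum>n. f n" and ?B = "\<Sum>n. g n"
  have hf: "(f has_sum ?A) UNIV" and hg: "(g has_sum ?B) UNIV"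
    using f g by (auto intro!: norm_summable_imp_has_sum summable_sums simp: summable_norm_cancel)
  have nf: "((\<lambda>n. norm (f n)) has_sum (\<Sum>n. norm (f n))) UNIV"
   and ng: "((\<lambda>n. norm (g n)) has_sum (\<Sum>n. norm (g n))) UNIV"
    using f g by (auto intro!: sums_nonneg_imp_has_sum summable_sums)
  have "(\<lambda>p. norm (f (fst p) * g (snd p))) summable_on UNIV \<times> UNIV"
  proof (rule summable_on_SigmaI)
    show "((\<lambda>y. norm (f (fst (x, y)) * g (snd (x, y)))) has_sum norm (f x) * (\<Sum>n. norm (g n))) UNIV" for x
      unfolding norm_mult fst_conv snd_conv by (intro has_sum_cmult_right ng)
    show "(\<lambda>x. norm (f x) * (\<Sum>n. norm (g n))) summable_on UNIV"
      using has_sum_cmult_left[OF nf] by (auto simp: summable_on_def)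
  qed auto
  then have abs: "(\<lambda>p. f (fst p) * g (snd p)) summable_on UNIV \<times> UNIV"
    by (rule abs_summable_summable)
  have "((\<lambda>p. f (fst p) * g (snd p)) has_sum ?A * ?B) (UNIV \<times> UNIV)"
  proof (rule has_sum_SigmaI[OF _ _ abs])
    show "((\<lambda>y. f (fst (x, y)) * g (snd (x, y))) has_sum f x * ?B) UNIV" for x
      unfolding fst_conv snd_conv by (intro has_sum_cmult_right hg)
    show "((\<lambda>x. f x * ?B) has_sum ?A * ?B) UNIV"
      by (intro has_sum_cmult_left hf)
  qed
  then have "((\<lambda>p. f (fst p) * g (snd p)) has_sum ?A * ?B) ({0<..} \<times> {0<..})"
    by (rule has_sum_cong_neutral[THEN iffD1, rotated -1]) (auto simp: f0 g0 intro!: Nat.gr0I)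
  also have "?this \<longleftrightarrow> ((\<lambda>p. f (snd p) * g (fst p div snd p)) has_sum ?A * ?B) (SIGMA n:{0<..}. {d. d dvd n})"
    by (rule has_sum_reindex_bij_witness[of _ "\<lambda>p. (snd p, fst p div snd p)" "\<lambda>p. (fst p * snd p, fst p)"])
       (auto simp: dvd_div_eq_0_iff intro!: Nat.gr0I)
  finally have "(h has_sum ?A * ?B) {0<..}"
    by (rule has_sum_Sigma') (auto simp: h intro!: has_sum_finiteI)
  then have "(h has_sum ?A * ?B) UNIV"
    by (rule has_sum_cong_neutral[THEN iffD1, rotated -1]) (auto simp: h0)
  then show ?thesis by (rule has_sum_imp_sums)
qed

text \<open>The index 0 is harmless, because \<open>0 powr z = 0\<close>.\<close>

definition zeta_series :: "complex \<Rightarrow> complex" where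
  "zeta_series s = (\<Sum>n. of_nat n powr (-s))"

definition mangoldt_series :: "complex \<Rightarrow> complex" where
  "mangoldt_series s = (\<Sum>n. mangoldt n * of_nat n powr (-s))"

lemma summable_norm_zeta_series:
  assumes "Re s > 1"
  shows "summable (\<lambda>n. norm (of_nat n powr (-s) :: complex))"
  using summable_nat_powr[OF assms] by simp

lemma summable_mangoldt_powr:
  fixes a :: real
  assumes "a > 1"
  shows "summable (\<lambda>n. mangoldt n * real n powr (-a))"
proof (rule summable_comparison_test[OF _ summable_ln_nat_powr[OF assms]])
  have "norm (mangoldt n * real n powr (-a)) \<le> ln (real n) * real n powr (-a)" for n
    by (cases "n = 0") (auto simp: abs_mult intro!: mult_right_mono mangoldt_le)
  then show "\<exists>N. \<forall>n\<ge>N. norm (mangoldt n * real n powr (-a)) \<le> ln (real n) * real n powr (-a)"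
    by blast
qed

lemma summable_norm_mangoldt_series:
  assumes "Re s > 1"
  shows "summable (\<lambda>n. norm (mangoldt n * of_nat n powr (-s) :: complex))"
  using summable_mangoldt_powr[OF assms] by (simp add: norm_mult)

lemma zeta_series_has_field_derivative:
  assumes "Re s > 1"
  shows "(zeta_series has_field_derivative (\<Sum>n. - of_real (ln n) * of_nat n powr (-s))) (at s)"
proof -
  let ?S = "{s. Re s > 1}" and ?f = "\<lambda>n s. of_nat n powr (-s) :: complex"
  have S: "open ?S" by (rule open_halfspace_Re_gt)
  have der: "(?f n has_field_derivative (- of_real (ln n) * of_nat n powr (-s))) (at s)" for n s
  proof (cases "n = 0")
    case False
    then show ?thesis by (auto simp: powr_def Ln_of_nat intro!: derivative_eq_intros)
  qed auto
  \<comment> \<open>A majorant near \<open>x\<close>: within half the distance from \<open>x\<close>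
    to the line \<open>Re s = 1\<close>, real parts stay above the midpoint
    \<open>(Re x + 1) / 2\<close>, which exceeds 1.\<close>
  have "\<exists>d h. 0 < d \<and> summable h \<and> (\<forall>\<^sub>F n in sequentially. \<forall>y\<in>ball x d \<inter> ?S. norm (?f n y) \<le> h n)"
    if "x \<in> ?S" for x
  proof (intro exI conjI always_eventually allI ballI)
    show "0 < (Re x - 1) / 2" using that by simp
    show "summable (\<lambda>n. real n powr (-((Re x + 1) / 2)))"
      using that by (intro summable_nat_powr) auto
    fix n y assume "y \<in> ball x ((Re x - 1) / 2) \<inter> ?S"
    then have "\<bar>Re (x - y)\<bar> < (Re x - 1) / 2"
      using abs_Re_le_cmod[of "x - y"] by (auto simp: dist_norm)
    then have "(Re x + 1) / 2 \<le> Re y" by (simp add: field_simps abs_if split: if_splits)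
    then show "norm (?f n y) \<le> real n powr (-((Re x + 1) / 2))"
      by (cases "n = 0") (auto intro!: powr_mono)
  qed
  from series_and_derivative_comparison_local[OF S der this]
  obtain g g' where g: "\<And>x. x \<in> ?S \<Longrightarrow> (\<lambda>n. ?f n x) sums g x"
    "\<And>x. x \<in> ?S \<Longrightarrow> (\<lambda>n. - of_real (ln n) * of_nat n powr (-x)) sums g' x"
    "\<And>x. x \<in> ?S \<Longrightarrow> (g has_field_derivative g' x) (at x)"
    by blast
  have "(zeta_series has_field_derivative g' s) (at s)"
  proof (rule has_field_derivative_transform_within_open[OF g(3) S])
    show "g x = zeta_series x" if "x \<in> ?S" for x
      using sums_unique[OF g(1)[OF that]] by (simp add: zeta_series_def)
  qed (use assms in auto)
  with sums_unique[OF g(2)[of s]] assms show ?thesis by simp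
qed

text \<open>The Dirichlet convolution of \<open>mangoldt\<close> with the constant 1 is
  \<open>ln\<close>, and \<open>- ln n\<close> is the factor that differentiation puts on the n-th
  term of the zeta series.\<close>

lemma mangoldt_series_mult_zeta_series:
  assumes "Re s > 1"
  shows "mangoldt_series s * zeta_series s = - deriv zeta_series s"
proof -
  have "(\<lambda>n. of_real (ln n) * of_nat n powr (-s)) sums (mangoldt_series s * zeta_series s)"
    unfolding zeta_series_def mangoldt_series_def
  proof (rule sums_dirichlet_product)
    show "summable (\<lambda>n. norm (of_nat n powr (-s) :: complex))"
      using assms by (rule summable_norm_zeta_series)
    show "summable (\<lambda>n. norm (mangoldt n * of_nat n powr (-s) :: complex))"
      using assms by (rule summable_norm_mangoldt_series)
    fix n :: nat assume n: "n > 0"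
    have "(\<Sum>d | d dvd n. mangoldt d * of_nat d powr (-s) * of_nat (n div d) powr (-s)) =
          (\<Sum>d | d dvd n. mangoldt d * of_nat n powr (-s) :: complex)"
    proof (rule sum.cong[OF refl])
      fix d assume "d \<in> {d. d dvd n}"
      then obtain k where k: "n = d * k" by auto
      then have "n div d = k" using n by auto
      then show "mangoldt d * of_nat d powr (-s) * of_nat (n div d) powr (-s) =
          (mangoldt d * of_nat n powr (-s) :: complex)"
        by (simp add: k powr_times_real)
    qed
    also have "\<dots> = of_real (ln n) * of_nat n powr (-s)"
      using n by (simp add: mangoldt_sum flip: sum_distrib_right)
    finally show "of_real (ln n) * of_nat n powr (-s) =
       (\<Sum>d | d dvd n. mangoldt d * of_nat d powr (-s) * of_nat (n div d) powr (-s) :: complex)" ..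
  qed auto
  from sums_unique[OF sums_minus[OF this]]
  have "deriv zeta_series s = - (mangoldt_series s * zeta_series s)"
    using DERIV_imp_deriv[OF zeta_series_has_field_derivative[OF assms]]
    by simp
  then show ?thesis by simp
qed

text \<open>With \<open>m = n + 1\<close>, the term is \<open>s - 1\<close> times the difference of \<open>m\<^sup>-\<^sup>s\<close> and the integral of
  \<open>x\<^sup>-\<^sup>s\<close> over \<open>[m, m + 1]\<close>. These integrals add up to \<open>1 / (s - 1)\<close>.\<close>
definition zeta_reg_term :: "nat \<Rightarrow> complex \<Rightarrow> complex" where
  "zeta_reg_term n s = (s - 1) * of_nat (Suc n) powr (-s)
     + (of_nat (Suc (Suc n)) powr (1 - s) - of_nat (Suc n) powr (1 - s))"

text \<open>Continues \<open>(s - 1) * zeta_series s\<close> from \<open>Re s > 1\<close> to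
  \<open>Re s > 0\<close>. The leading 1 offsets the telescoping differences in
  \<open>zeta_reg_term\<close>, which add up to -1 for \<open>Re s > 1\<close>. The pole of zeta at
  1 turns into the value 1.\<close>

definition zeta_reg :: "complex \<Rightarrow> complex" where
  "zeta_reg s = 1 + (\<Sum>n. zeta_reg_term n s)"

lemma norm_powr_diff_le:
  fixes a x :: real
  assumes a: "a > 0" and s: "Re s > 0" and x: "a \<le> x" "x \<le> a + 1"
  shows "norm (of_real a powr (-s) - of_real x powr (-s) :: complex) \<le> norm s * a powr (- Re s - 1)"
proof -
  let ?S = "closed_segment (of_real a :: complex) (of_real x)"
  have pos: "z \<in> \<real> \<and> a \<le> Re z" if "z \<in> ?S" for z
    using that x by (auto simp: closed_segment_of_real closed_segment_eq_real_ivl)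
  have "norm (of_real a powr (-s) - of_real x powr (-s) :: complex)
      \<le> norm s * a powr (- Re s - 1) * norm (of_real a - of_real x :: complex)"
  proof (rule field_differentiable_bound[where S = ?S and f = "\<lambda>z. z powr (-s)" and f' = "\<lambda>z. -s * z powr (-s-1)"])
    fix z assume z: "z \<in> ?S"
    then have z': "z \<notin> \<real>\<^sub>\<le>\<^sub>0" using pos[OF z] a by (auto simp: complex_nonpos_Reals_iff)
    then show "((\<lambda>z. z powr (-s)) has_field_derivative -s * z powr (-s-1)) (at z within ?S)"
      by (auto intro!: derivative_eq_intros)
    have "norm (-s * z powr (-s-1)) = norm s * Re z powr (- Re s - 1)"
      using pos[OF z] a by (simp add: norm_mult norm_powr_real_powr)
    also have "\<dots> \<le> norm s * a powr (- Re s - 1)"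
      using pos[OF z] a s by (intro mult_left_mono powr_mono2') auto
    finally show "norm (-s * z powr (-s-1)) \<le> norm s * a powr (- Re s - 1)" .
  qed auto
  also have "norm (of_real a - of_real x :: complex) \<le> 1"
    using x by (simp flip: of_real_diff)
  finally show ?thesis
    by (simp add: mult_left_mono)
qed

text \<open>The mean value inequality is applied twice. The term is the increment over
  \<open>[a, a + 1]\<close> of a function with derivative
  \<open>(s - 1) * (a powr (-s) - z powr (-s))\<close>, and this difference is again small by
  \<open>norm_powr_diff_le\<close>. The extra power of \<open>n\<close> gained is what makes the
  series converge for all \<open>Re s > 0\<close>.\<close>

lemma norm_zeta_reg_term_le:
  assumes s: "Re s > 0"
  shows "norm (zeta_reg_term n s) \<le> norm (s - 1) * norm s * real (Suc n) powr (- Re s - 1)"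
proof -
  define a where "a = real (Suc n)"
  have a: "a > 0" by (simp add: a_def)
  let ?S = "closed_segment (of_real a :: complex) (of_real (a + 1))"
  let ?\<phi> = "\<lambda>z. (s - 1) * of_real a powr (-s) * z + z powr (1 - s) :: complex"
  have pos: "\<exists>x. z = of_real x \<and> a \<le> x \<and> x \<le> a + 1" if "z \<in> ?S" for z
    using that unfolding closed_segment_of_real by (auto simp: closed_segment_eq_real_ivl simp del: of_real_add)
  have "norm (?\<phi> (of_real (a + 1)) - ?\<phi> (of_real a)) \<le>
     norm (s - 1) * (norm s * a powr (- Re s - 1)) * norm (of_real (a + 1) - of_real a :: complex)"
  proof (rule field_differentiable_bound[where S = ?S and f' = "\<lambda>z. (s - 1) * (of_real a powr (-s) - z powr (-s))"])
    fix z assume z: "z \<in> ?S"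
    then obtain x where x: "z = of_real x" "a \<le> x" "x \<le> a + 1" using pos by blast
    then have z': "z \<notin> \<real>\<^sub>\<le>\<^sub>0" using a by (auto simp: complex_nonpos_Reals_iff)
    then show "(?\<phi> has_field_derivative (s - 1) * (of_real a powr (-s) - z powr (-s))) (at z within ?S)"
      by (auto intro!: derivative_eq_intros simp: algebra_simps)
    show "norm ((s - 1) * (of_real a powr (-s) - z powr (-s))) \<le> norm (s - 1) * (norm s * a powr (- Re s - 1))"
      unfolding norm_mult x(1) using norm_powr_diff_le[OF a s x(2,3)] by (intro mult_left_mono) auto
  qed auto
  moreover have "?\<phi> (of_real (a + 1)) - ?\<phi> (of_real a) = zeta_reg_term n s"
    by (simp add: zeta_reg_term_def a_def algebra_simps)
  ultimately show ?thesis by (simp add: a_def mult_ac flip: of_real_diff)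
qed

lemma zeta_reg_holomorphic: "zeta_reg holomorphic_on {s. Re s > 0}"
proof -
  let ?S = "{s. Re s > 0}"
  have S: "open ?S" by (rule open_halfspace_Re_gt)
  have der: "zeta_reg_term n field_differentiable (at s)" for n s
    unfolding zeta_reg_term_def
    by (rule holomorphic_on_imp_differentiable_at[of _ UNIV])
       (auto intro!: holomorphic_intros)
  have "\<exists>d h. 0 < d \<and> summable h \<and> (\<forall>\<^sub>F n in sequentially. \<forall>y\<in>ball x d \<inter> ?S. norm (zeta_reg_term n y) \<le> h n)"
    if "x \<in> ?S" for x
  proof (intro exI conjI always_eventually allI ballI)
    show "0 < Re x / 2" using that by simp
    let ?C = "(norm x + Re x / 2 + 1) * (norm x + Re x / 2)"
    have "summable (\<lambda>n. real n powr (-(Re x / 2 + 1)))"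
      using that by (intro summable_nat_powr) auto
    then show "summable (\<lambda>n. ?C * real (Suc n) powr (-(Re x / 2 + 1)))"
      by (intro summable_mult) (subst summable_Suc_iff)
    fix n y assume y: "y \<in> ball x (Re x / 2) \<inter> ?S"
    then have d: "norm (y - x) < Re x / 2" by (simp add: dist_norm norm_minus_commute)
    then have "\<bar>Re (y - x)\<bar> < Re x / 2"
      using abs_Re_le_cmod[of "y - x"] by linarith
    then have Re: "Re x / 2 \<le> Re y" by (simp add: field_simps abs_if split: if_splits)
    have ny: "norm y \<le> norm x + Re x / 2"
      using d norm_triangle_sub[of y x] by linarith
    moreover have "norm (y - 1) \<le> norm y + 1"
      using norm_triangle_ineq4[of y 1] by simp
    ultimately have "norm (y - 1) \<le> norm x + Re x / 2 + 1" by linarith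
    then have C: "norm (y - 1) * norm y \<le> ?C"
      using ny that by (intro mult_mono) (auto intro!: add_nonneg_nonneg)
    have "norm (zeta_reg_term n y) \<le> norm (y - 1) * norm y * real (Suc n) powr (- Re y - 1)"
      using y by (intro norm_zeta_reg_term_le) auto
    also have "\<dots> \<le> ?C * real (Suc n) powr (-(Re x / 2 + 1))"
      using Re by (intro mult_mono[OF C] powr_mono order_trans[OF _ C]) auto
    finally show "norm (zeta_reg_term n y) \<le> ?C * real (Suc n) powr (-(Re x / 2 + 1))" .
  qed
  from series_and_derivative_comparison_local[OF S field_differentiable_derivI[OF der] this]
  obtain g g' where g: "\<And>x. x \<in> ?S \<Longrightarrow> (\<lambda>n. zeta_reg_term n x) sums g x"
    "\<And>x. x \<in> ?S \<Longrightarrow> (g has_field_derivative g' x) (at x)"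
    by blast
  have "(\<lambda>s. 1 + g s) holomorphic_on ?S"
    using g(2) S by (intro holomorphic_intros) (auto simp: holomorphic_on_open)
  then show ?thesis
    by (rule holomorphic_transform) (simp add: zeta_reg_def sums_unique[OF g(1)])
qed

lemma zeta_reg_1 [simp]: "zeta_reg 1 = 1"
  by (simp add: zeta_reg_def zeta_reg_term_def del: of_nat_Suc)

lemma zeta_reg_eq:
  assumes s: "Re s > 1"
  shows "zeta_reg s = (s - 1) * zeta_series s"
proof -
  have "summable (\<lambda>n. of_nat n powr (-s) :: complex)"
    using summable_norm_zeta_series[OF s] by (rule summable_norm_cancel)
  then have "(\<lambda>n. of_nat n powr (-s)) sums zeta_series s"
    unfolding zeta_series_def by (rule summable_sums)
  then have "(\<lambda>n. of_nat (Suc n) powr (-s)) sums zeta_series s"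
    by (subst sums_Suc_iff) simp
  moreover have "(\<lambda>n. of_nat (Suc (Suc n)) powr (1 - s) - of_nat (Suc n) powr (1 - s) :: complex)
     sums (0 - of_nat (Suc 0) powr (1 - s))"
  proof (rule telescope_sums)
    show "(\<lambda>n. of_nat (Suc n) powr (1 - s) :: complex) \<longlonglongrightarrow> 0"
      using s by (intro tendsto_neg_powr_complex_of_nat filterlim_Suc) auto
  qed
  ultimately have "(\<lambda>n. zeta_reg_term n s) sums ((s - 1) * zeta_series s + (0 - of_nat (Suc 0) powr (1 - s)))"
    unfolding zeta_reg_term_def by (intro sums_add sums_mult)
  then show ?thesis by (simp add: zeta_reg_def sums_iff)
qed

text \<open>Product rule for \<open>(s - 1) * zeta_series s\<close>, combined with the convolution
  identity. No division occurs, so possible zeros of \<open>zeta_reg\<close> need no separate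
  treatment here.\<close>

lemma zeta_reg_mult_mangoldt_series:
  assumes s: "Re s > 1"
  shows "zeta_reg s * mangoldt_series s = zeta_series s - deriv zeta_reg s"
proof -
  have "(zeta_reg has_field_derivative (zeta_series s + (s - 1) * deriv zeta_series s)) (at s)"
  proof (rule has_field_derivative_transform_within_open[of "\<lambda>s. (s - 1) * zeta_series s" _ _ "{s. Re s > 1}"])
    have "(zeta_series has_field_derivative deriv zeta_series s) (at s)"
      using zeta_series_has_field_derivative[OF s] by (simp add: DERIV_imp_deriv)
    then show "((\<lambda>s. (s - 1) * zeta_series s) has_field_derivative
        (zeta_series s + (s - 1) * deriv zeta_series s)) (at s)"
      by (auto intro!: derivative_eq_intros)
  qed (use s in \<open>auto simp: zeta_reg_eq open_halfspace_Re_gt\<close>)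
  then have "deriv zeta_reg s = zeta_series s + (s - 1) * deriv zeta_series s"
    by (rule DERIV_imp_deriv)
  also have "deriv zeta_series s = - (mangoldt_series s * zeta_series s)"
    using mangoldt_series_mult_zeta_series[OF s] by simp
  finally show ?thesis by (simp add: zeta_reg_eq[OF s] algebra_simps)
qed

lemma mangoldt_series_eq:
  assumes s: "Re s > 1" and nz: "zeta_reg s \<noteq> 0"
  shows "mangoldt_series s = 1 / (s - 1) - deriv zeta_reg s / zeta_reg s"
proof -
  have "s \<noteq> 1" using s by auto
  then have "zeta_series s / zeta_reg s = 1 / (s - 1)"
    using nz by (auto simp: zeta_reg_eq[OF s])
  with zeta_reg_mult_mangoldt_series[OF s] nz show ?thesis
    by (metis diff_divide_distrib nonzero_mult_div_cancel_left)
qed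

text \<open>Here \<open>m\<close> is the order of vanishing at \<open>s\<close>: with
  \<open>zeta_reg w = h w * (w - s) ^ m\<close> and \<open>h\<close> free of zeros near
  \<open>s\<close>, the logarithmic derivative has residue \<open>m\<close>. The second conclusion,
  that zeros are isolated, permits the formula for \<open>mangoldt_series\<close> just to the right
  of \<open>s\<close>.\<close>

lemma zeta_reg_log_deriv_tendsto:
  assumes s: "Re s > 0"
  obtains m :: nat where
    "((\<lambda>d. of_real d * (deriv zeta_reg (s + of_real d) / zeta_reg (s + of_real d))) \<longlongrightarrow> of_nat m) (at_right 0)"
    "\<forall>\<^sub>F d in at_right 0. zeta_reg (s + of_real d) \<noteq> 0"
    "zeta_reg s = 0 \<Longrightarrow> m > 0"
proof -
  let ?S = "{s. Re s > 0}"
  define m where "m = nat (zorder zeta_reg s)"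
  define h where "h = zor_poly zeta_reg s"
  have "(if zeta_reg s = 0 then zorder zeta_reg s > 0 else zorder zeta_reg s = 0) \<and>
     (\<exists>r. r > 0 \<and> cball s r \<subseteq> ?S \<and> h holomorphic_on cball s r
    \<and> (\<forall>w\<in>cball s r. zeta_reg w = h w * (w - s) ^ nat (zorder zeta_reg s) \<and> h w \<noteq> 0))"
    unfolding h_def
  proof (rule zorder_exist_zero)
    show "connected ?S" by (intro convex_connected convex_halfspace_Re_gt)
    \<comment> \<open>A finite order requires that the function is not identically zero; its value
      at 1 shows this.\<close>
    show "\<exists>w\<in>?S. zeta_reg w \<noteq> 0" by (intro bexI[of _ 1]) auto
  qed (use s zeta_reg_holomorphic open_halfspace_Re_gt in auto)
  then have z: "if zeta_reg s = 0 then zorder zeta_reg s > 0 else zorder zeta_reg s = 0"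
    and "\<exists>r. r > 0 \<and> h holomorphic_on cball s r
      \<and> (\<forall>w\<in>cball s r. zeta_reg w = h w * (w - s) ^ m \<and> h w \<noteq> 0)"
    unfolding m_def by (rule conjunct1, meson)
  then obtain r where r: "r > 0" "h holomorphic_on cball s r"
      "\<And>w. w \<in> cball s r \<Longrightarrow> zeta_reg w = h w * (w - s) ^ m \<and> h w \<noteq> 0"
    by meson
  from z have m0: "zeta_reg s = 0 \<Longrightarrow> m > 0"
    by (simp add: m_def)
  have hb: "h holomorphic_on ball s r"
    using r(2) ball_subset_cball by (rule holomorphic_on_subset)
  have eq: "(w - s) * (deriv zeta_reg w / zeta_reg w) = (w - s) * (deriv h w / h w) + of_nat m"
    if w: "w \<in> ball s r" "w \<noteq> s" for w
  proof -
    have dh: "(h has_field_derivative deriv h w) (at w)"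
      using hb w(1) by (intro holomorphic_derivI[of h "ball s r"]) auto
    have "(zeta_reg has_field_derivative
        (deriv h w * (w - s) ^ m + h w * (of_nat m * (w - s) ^ (m - 1)))) (at w)"
    proof (rule has_field_derivative_transform_within_open[of "\<lambda>w. h w * (w - s) ^ m" _ _ "ball s r"])
      show "((\<lambda>w. h w * (w - s) ^ m) has_field_derivative
        (deriv h w * (w - s) ^ m + h w * (of_nat m * (w - s) ^ (m - 1)))) (at w)"
        by (rule derivative_eq_intros dh refl | simp)+
    qed (use w r(3) in auto)
    then have "deriv zeta_reg w = deriv h w * (w - s) ^ m + h w * (of_nat m * (w - s) ^ (m - 1))"
      by (rule DERIV_imp_deriv)
    moreover have "zeta_reg w = h w * (w - s) ^ m" and nz: "h w \<noteq> 0"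
      using r(3)[of w] w by auto
    moreover define x where "x = w - s"
    ultimately have "(w - s) * (deriv zeta_reg w / zeta_reg w) =
       (x * (deriv h w * x ^ m + h w * (of_nat m * x ^ (m - 1)))) / (h w * x ^ m)"
      by simp
    also have "x * (of_nat m * x ^ (m - 1)) = of_nat m * x ^ m" by (cases m) auto
    then have "x * (deriv h w * x ^ m + h w * (of_nat m * x ^ (m - 1)))
        = x * deriv h w * x ^ m + of_nat m * (h w * x ^ m)"
      by (metis distrib_left mult.assoc mult.left_commute)
    also have "(x * deriv h w * x ^ m + of_nat m * (h w * x ^ m)) / (h w * x ^ m)
        = x * (deriv h w / h w) + of_nat m"
      using nz w(2) by (simp add: add_divide_distrib x_def)
    finally show ?thesis by (simp add: x_def)
  qed
  have lim: "((\<lambda>w. (w - s) * (deriv h w / h w) + of_nat m) \<longlongrightarrow> (s - s) * (deriv h s / h s) + of_nat m) (at s)"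
  proof -
    have "continuous_on (ball s r) (\<lambda>w. (w - s) * (deriv h w / h w) + of_nat m)"
      using hb r(3) by (intro continuous_intros holomorphic_on_imp_continuous_on holomorphic_deriv) auto
    then have "isCont (\<lambda>w. (w - s) * (deriv h w / h w) + of_nat m) s"
      using r(1) by (simp add: continuous_on_eq_continuous_at)
    then show ?thesis by (simp add: isCont_def)
  qed
  have ev: "\<forall>\<^sub>F w in at s. w \<in> ball s r \<and> w \<noteq> s"
    unfolding eventually_at_filter
    by (rule eventually_mono[OF eventually_nhds_in_open[of "ball s r"]]) (use r(1) in auto)
  have path: "filterlim (\<lambda>d::real. s + of_real d) (at s) (at_right 0)"
    unfolding filterlim_at
  proof
    have "((\<lambda>d::real. s + of_real d) \<longlongrightarrow> s + of_real 0) (at_right 0)"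
      by (intro tendsto_intros)
    then show "((\<lambda>d::real. s + of_real d) \<longlongrightarrow> s) (at_right 0)" by simp
    show "\<forall>\<^sub>F d in at_right 0. s + of_real d \<in> UNIV \<and> s + of_real d \<noteq> s"
      by (auto simp: eventually_at_filter)
  qed
  have "((\<lambda>w. (w - s) * (deriv zeta_reg w / zeta_reg w)) \<longlongrightarrow> of_nat m) (at s)"
  proof (rule Lim_transform_eventually)
    show "((\<lambda>w. (w - s) * (deriv h w / h w) + of_nat m) \<longlongrightarrow> of_nat m) (at s)" using lim by simp
    show "\<forall>\<^sub>F w in at s. (w - s) * (deriv h w / h w) + of_nat m = (w - s) * (deriv zeta_reg w / zeta_reg w)"
      using ev by eventually_elim (metis eq)
  qed
  from filterlim_compose[OF this path]
  have 1: "((\<lambda>d. of_real d * (deriv zeta_reg (s + of_real d) / zeta_reg (s + of_real d))) \<longlongrightarrow> of_nat m) (at_right 0)"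
    by simp
  have "\<forall>\<^sub>F w in at s. zeta_reg w \<noteq> 0"
    using ev by eventually_elim (use r(3) in auto)
  from eventually_compose_filterlim[OF this path] show ?thesis
    using that[OF 1] m0 by blast
qed

section \<open>Zeros on the line of real part one\<close>

lemma three_four_one_nonneg:
  fixes x :: real
  shows "3 + 4 * cos x + cos (2 * x) \<ge> 0"
proof -
  have "3 + 4 * cos x + cos (2 * x) = 2 * (1 + cos x)\<^sup>2"
    unfolding cos_double_cos by (simp add: power2_eq_square algebra_simps)
  then show ?thesis by simp
qed

lemma nat_powr_Complex:
  "of_nat n powr (- Complex a t) = of_real (real n powr (-a)) * cis (- t * ln (real n))"
proof (cases "n = 0")
  case False
  then show ?thesis by (auto simp: powr_def Ln_of_nat exp_eq_polar mult.commute)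
qed auto

lemma Re_mangoldt_series_sums:
  assumes "a > 1"
  shows "(\<lambda>n. mangoldt n * real n powr (-a) * cos (t * ln (real n))) sums Re (mangoldt_series (Complex a t))"
proof -
  have "(\<lambda>n. mangoldt n * of_nat n powr (- Complex a t)) sums mangoldt_series (Complex a t)"
    unfolding mangoldt_series_def using assms
    by (intro summable_sums summable_norm_cancel[OF summable_norm_mangoldt_series]) auto
  from sums_Re[OF this] show ?thesis
    unfolding nat_powr_Complex by (simp add: mult.assoc)
qed

text \<open>Holds term by term: the weights \<open>mangoldt n * real n powr (-a)\<close> are
  nonnegative, and they multiply the trigonometric polynomial of
  \<open>three_four_one_nonneg\<close> at \<open>t * ln (real n)\<close>.\<close>

lemma Re_mangoldt_series_three_four_one:
  assumes "a > 1"
  shows "3 * Re (mangoldt_series (Complex a 0)) + 4 * Re (mangoldt_series (Complex a t))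
           + Re (mangoldt_series (Complex a (2 * t))) \<ge> 0"
proof -
  have "(\<lambda>n. 3 * (mangoldt n * real n powr (-a) * cos (0 * ln (real n)))
          + 4 * (mangoldt n * real n powr (-a) * cos (t * ln (real n)))
          + mangoldt n * real n powr (-a) * cos ((2 * t) * ln (real n)))
      sums (3 * Re (mangoldt_series (Complex a 0)) + 4 * Re (mangoldt_series (Complex a t))
           + Re (mangoldt_series (Complex a (2 * t))))"
    using assms by (intro sums_add sums_mult Re_mangoldt_series_sums)
  moreover have "3 * (mangoldt n * real n powr (-a) * cos (0 * ln (real n)))
          + 4 * (mangoldt n * real n powr (-a) * cos (t * ln (real n)))
          + mangoldt n * real n powr (-a) * cos ((2 * t) * ln (real n)) \<ge> 0" for n
  proof -
    have "0 \<le> mangoldt n * real n powr (-a) * (3 + 4 * cos (t * ln (real n)) + cos (2 * (t * ln (real n))))"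
      by (intro mult_nonneg_nonneg mangoldt_nonneg three_four_one_nonneg) auto
    then show ?thesis by (simp add: algebra_simps)
  qed
  ultimately show ?thesis by (rule sums_le[OF _ sums_zero, rotated])
qed

text \<open>The limit is the residue of \<open>mangoldt_series\<close> at \<open>1 + i t\<close>:
  the pole of zeta contributes 1 when \<open>t = 0\<close>, and a zero of order \<open>m\<close> of
  \<open>zeta_reg\<close> contributes \<open>-m\<close>.\<close>

lemma mangoldt_series_tendsto:
  obtains m :: nat where
    "((\<lambda>d. d * Re (mangoldt_series (Complex (1 + d) t))) \<longlongrightarrow> (if t = 0 then 1 else 0) - real m) (at_right 0)"
    "zeta_reg (Complex 1 t) = 0 \<Longrightarrow> m > 0"
proof -
  define s where "s = Complex 1 t"
  have "Re s > 0" by (simp add: s_def)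
  from zeta_reg_log_deriv_tendsto[OF this] obtain m :: nat where m:
    "((\<lambda>d. of_real d * (deriv zeta_reg (s + of_real d) / zeta_reg (s + of_real d))) \<longlongrightarrow> of_nat m) (at_right 0)"
    "\<forall>\<^sub>F d in at_right 0. zeta_reg (s + of_real d) \<noteq> 0" "zeta_reg s = 0 \<Longrightarrow> m > 0"
    by blast
  have "((\<lambda>d::real. of_real d / (s - 1 + of_real d)) \<longlongrightarrow> (if t = 0 then 1 else 0)) (at_right 0)"
  proof (cases "t = 0")
    case True
    then have "\<forall>\<^sub>F d::real in at_right 0. 1 = of_real d / (s - 1 + of_real d)"
      by (auto simp: s_def eventually_at_filter simp flip: one_complex.code)
    then have "((\<lambda>d::real. of_real d / (s - 1 + of_real d)) \<longlongrightarrow> 1) (at_right 0)"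
      by (rule Lim_transform_eventually[OF tendsto_const])
    then show ?thesis using True by simp
  next
    case False
    then have "s - 1 \<noteq> 0" by (auto simp: s_def complex_eq_iff)
    then have "((\<lambda>d::real. of_real d / (s - 1 + of_real d)) \<longlongrightarrow> of_real 0 / (s - 1 + of_real 0)) (at_right 0)"
      by (intro tendsto_intros) auto
    then show ?thesis using False by simp
  qed
  from tendsto_diff[OF this m(1)]
  have "((\<lambda>d. of_real d / (s - 1 + of_real d)
      - of_real d * (deriv zeta_reg (s + of_real d) / zeta_reg (s + of_real d)))
      \<longlongrightarrow> (if t = 0 then 1 else 0) - of_nat m) (at_right 0)" .
  moreover have "\<forall>\<^sub>F d in at_right 0. of_real d / (s - 1 + of_real d)
      - of_real d * (deriv zeta_reg (s + of_real d) / zeta_reg (s + of_real d))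
      = of_real d * mangoldt_series (s + of_real d)"
    using m(2) eventually_at_right_less[of 0]
  proof eventually_elim
    case (elim d)
    have "mangoldt_series (s + of_real d) = 1 / (s + of_real d - 1) -
        deriv zeta_reg (s + of_real d) / zeta_reg (s + of_real d)"
      using elim by (intro mangoldt_series_eq) (auto simp: s_def)
    moreover have "s + of_real d - 1 = s - 1 + of_real d" by simp
    ultimately show ?case by (simp add: right_diff_distrib)
  qed
  ultimately have "((\<lambda>d. of_real d * mangoldt_series (s + of_real d))
      \<longlongrightarrow> (if t = 0 then 1 else 0) - of_nat m) (at_right 0)"
    by (rule Lim_transform_eventually)
  from tendsto_Re[OF this]
  have "((\<lambda>d. Re (of_real d * mangoldt_series (s + of_real d)))
      \<longlongrightarrow> Re ((if t = 0 then 1 else 0) - of_nat m)) (at_right 0)" .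
  also have "(\<lambda>d. Re (of_real d * mangoldt_series (s + of_real d))) =
      (\<lambda>d. d * Re (mangoldt_series (Complex (1 + d) t)))"
    by (simp add: s_def complex_of_real_def complex_add)
  also have "Re ((if t = 0 then 1 else 0) - of_nat m) = (if t = 0 then 1 else 0) - real m"
    by simp
  finally have "((\<lambda>d. d * Re (mangoldt_series (Complex (1 + d) t)))
      \<longlongrightarrow> (if t = 0 then 1 else 0) - real m) (at_right 0)" .
  then show ?thesis using that m(3) unfolding s_def by blast
qed

text \<open>Multiplying the 3-4-1 inequality by \<open>d\<close> and letting \<open>d\<close> tend
  to 0 bounds a combination of residues from below by 0. A zero at height \<open>t\<close> enters
  with weight 4, the pole only with weight 3, so the combination would be at most -1.\<close>

theorem zeta_reg_nonzero: "zeta_reg (Complex 1 t) \<noteq> 0"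
proof
  assume 0: "zeta_reg (Complex 1 t) = 0"
  then have "t \<noteq> 0" by (auto simp flip: one_complex.code)
  let ?P = "\<lambda>t d. d * Re (mangoldt_series (Complex (1 + d) t))"
  obtain m0 where m0: "(?P 0 \<longlongrightarrow> 1 - real m0) (at_right 0)"
    using mangoldt_series_tendsto[of 0] by auto
  obtain m1 where m1: "(?P t \<longlongrightarrow> - real m1) (at_right 0)" "m1 > 0"
    using mangoldt_series_tendsto[of t] 0 \<open>t \<noteq> 0\<close> by auto
  obtain m2 where m2: "(?P (2 * t) \<longlongrightarrow> - real m2) (at_right 0)"
    using mangoldt_series_tendsto[of "2 * t"] \<open>t \<noteq> 0\<close> by auto
  have "((\<lambda>d. 3 * ?P 0 d + 4 * ?P t d + ?P (2 * t) d) \<longlongrightarrow>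
      3 * (1 - real m0) + 4 * (- real m1) + (- real m2)) (at_right 0)"
    by (intro tendsto_intros m0 m1 m2)
  moreover have "\<forall>\<^sub>F d in at_right 0. 0 \<le> 3 * ?P 0 d + 4 * ?P t d + ?P (2 * t) d"
    using eventually_at_right_less[of "0::real"]
  proof eventually_elim
    case (elim d)
    then have "0 \<le> d * (3 * Re (mangoldt_series (Complex (1 + d) 0)) + 4 * Re (mangoldt_series (Complex (1 + d) t))
           + Re (mangoldt_series (Complex (1 + d) (2 * t))))"
      by (intro mult_nonneg_nonneg Re_mangoldt_series_three_four_one) auto
    then show ?case by (simp add: algebra_simps)
  qed
  ultimately have "0 \<le> 3 * (1 - real m0) + 4 * (- real m1) + (- real m2)"
    by (rule tendsto_lowerbound) auto
  moreover have "real m1 \<ge> 1" using \<open>m1 > 0\<close> by simp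
  ultimately show False by simp
qed

text \<open>Both \<open>mangoldt_series\<close> and \<open>zeta_series\<close> equal
  \<open>1 / (s - 1)\<close> plus a regular part; this is the difference of the regular parts. The
  case distinction fills in the removable singularity of a difference quotient of
  \<open>zeta_reg\<close> at 1, where \<open>zeta_reg 1 = 1\<close>.\<close>

definition mangoldt_zeta_diff :: "complex \<Rightarrow> complex" where
  "mangoldt_zeta_diff s = - deriv zeta_reg s / zeta_reg s
     - (if s = 1 then deriv zeta_reg 1 else (zeta_reg s - 1) / (s - 1))"

lemma mangoldt_zeta_diff_holomorphic:
  "mangoldt_zeta_diff holomorphic_on {s. Re s > 0 \<and> zeta_reg s \<noteq> 0}"
proof -
  let ?S = "{s. Re s > 0}"
  let ?T = "{s. Re s > 0 \<and> zeta_reg s \<noteq> 0}"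
  have "(\<lambda>s. if s = 1 then deriv zeta_reg 1 else (zeta_reg s - zeta_reg 1) / (s - 1)) holomorphic_on ?S"
    by (intro pole_lemma_open zeta_reg_holomorphic open_halfspace_Re_gt)
  then have "(\<lambda>s. if s = 1 then deriv zeta_reg 1 else (zeta_reg s - 1) / (s - 1)) holomorphic_on ?S"
    unfolding zeta_reg_1 .
  then have 1: "(\<lambda>s. if s = 1 then deriv zeta_reg 1 else (zeta_reg s - 1) / (s - 1)) holomorphic_on ?T"
    by (rule holomorphic_on_subset) auto
  have "deriv zeta_reg holomorphic_on ?S"
    by (intro holomorphic_deriv zeta_reg_holomorphic open_halfspace_Re_gt)
  then have 2: "deriv zeta_reg holomorphic_on ?T"
    by (rule holomorphic_on_subset) auto
  have 3: "zeta_reg holomorphic_on ?T"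
    by (rule holomorphic_on_subset[OF zeta_reg_holomorphic]) auto
  show ?thesis
    unfolding mangoldt_zeta_diff_def
    by (intro holomorphic_on_diff[OF _ 1] holomorphic_on_divide holomorphic_on_minus 2 3) auto
qed

lemma open_zeta_reg_nonzero: "open {s. Re s > 0 \<and> zeta_reg s \<noteq> 0}"
proof -
  have "open ({s. Re s > 0} \<inter> zeta_reg -` (-{0}))"
    by (intro continuous_open_preimage holomorphic_on_imp_continuous_on zeta_reg_holomorphic
          open_halfspace_Re_gt) auto
  also have "{s. Re s > 0} \<inter> zeta_reg -` (-{0}) = {s. Re s > 0 \<and> zeta_reg s \<noteq> 0}" by auto
  finally show ?thesis .
qed

lemma mangoldt_zeta_diff_eq:
  assumes s: "Re s > 1" and nz: "zeta_reg s \<noteq> 0"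
  shows "mangoldt_series s - zeta_series s = mangoldt_zeta_diff s"
proof -
  have "s \<noteq> 1" using s by auto
  then have "zeta_series s = 1 / (s - 1) + (zeta_reg s - 1) / (s - 1)"
    by (simp add: zeta_reg_eq[OF s] diff_divide_distrib)
  with mangoldt_series_eq[OF s nz] \<open>s \<noteq> 1\<close> show ?thesis
    by (simp add: mangoldt_zeta_diff_def)
qed

section \<open>The Fejer kernel\<close>

text \<open>The cosine transform of a triangular weight. Its compact frequency support
  \<open>[0, l]\<close> means that only a bounded segment of the line \<open>Re s = 1\<close> is
  ever used. Larger \<open>l\<close> gives a higher and narrower peak at 0.\<close>

definition fejer :: "real \<Rightarrow> real \<Rightarrow> real" where
  "fejer l u = integral {0..l} (\<lambda>t. (1 - t / l) * cos (t * u))"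

text \<open>Obtained by integrating by parts. The closed form exhibits nonnegativity and quadratic
  decay, neither of which is visible in the integral.\<close>

lemma fejer_eq:
  assumes l: "l > 0" and u: "u \<noteq> 0"
  shows "fejer l u = (1 - cos (l * u)) / (l * u\<^sup>2)"
proof -
  let ?F = "\<lambda>t. (1 - t / l) * sin (t * u) / u - cos (t * u) / (l * u\<^sup>2)"
  have "((\<lambda>t. (1 - t / l) * cos (t * u)) has_integral (?F l - ?F 0)) {0..l}"
  proof (rule fundamental_theorem_of_calculus)
    fix t
    have "(?F has_real_derivative (1 - t / l) * cos (t * u)) (at t within {0..l})"
      using l u by (auto intro!: derivative_eq_intros simp: field_simps power2_eq_square)
    then show "(?F has_vector_derivative (1 - t / l) * cos (t * u)) (at t within {0..l})"
      by (simp add: has_real_derivative_iff_has_vector_derivative)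
  qed (use l in auto)
  then have "fejer l u = ?F l - ?F 0"
    unfolding fejer_def by (rule integral_unique)
  also have "\<dots> = (1 - cos (l * u)) / (l * u\<^sup>2)"
    using l by (simp add: diff_divide_distrib)
  finally show ?thesis .
qed

lemma fejer_integrable:
  fixes l :: real
  shows "(\<lambda>t. (1 - t / l) * cos (t * u)) integrable_on {0..l}"
  unfolding divide_inverse by (intro integrable_continuous_real continuous_intros)

lemma has_integral_one_minus:
  fixes l :: real
  assumes l: "l > 0"
  shows "((\<lambda>t. 1 - t / l) has_integral l / 2) {0..l}"
proof -
  have "((\<lambda>t. 1 - t / l) has_integral ((l - l\<^sup>2 / (2 * l)) - (0 - 0\<^sup>2 / (2 * l)))) {0..l}"
    using l by (intro fundamental_theorem_of_calculus)
      (auto intro!: derivative_eq_intros simp flip: has_real_derivative_iff_has_vector_derivative)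
  then show ?thesis using l by (simp add: power2_eq_square field_simps)
qed

lemma fejer_0:
  assumes l: "l > 0"
  shows "fejer l 0 = l / 2"
  using integral_unique[OF has_integral_one_minus[OF l]] by (simp add: fejer_def)

lemma fejer_nonneg:
  assumes l: "l > 0"
  shows "fejer l u \<ge> 0"
  using l by (cases "u = 0") (auto simp: fejer_0 fejer_eq)

lemma fejer_le:
  assumes l: "l > 0" and u: "u \<noteq> 0"
  shows "fejer l u \<le> 2 / (l * u\<^sup>2)"
  using l cos_ge_minus_one[of "l * u"] unfolding fejer_eq[OF assms]
  by (intro divide_right_mono) auto

lemma fejer_le_half:
  assumes l: "l > 0"
  shows "fejer l u \<le> l / 2"
proof -
  have "fejer l u \<le> integral {0..l} (\<lambda>t. 1 - t / l)"
    unfolding fejer_def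
  proof (rule integral_le[OF fejer_integrable])
    show "(\<lambda>t. 1 - t / l) integrable_on {0..l}"
      using has_integral_one_minus[OF l] by blast
    show "(1 - t / l) * cos (t * u) \<le> 1 - t / l" if "t \<in> {0..l}" for t
      using l that cos_le_one[of "t * u"] by (intro mult_left_le) (auto simp: field_simps)
  qed
  then show ?thesis using integral_unique[OF has_integral_one_minus[OF l]] by simp
qed

lemma cos_ge_half:
  fixes x :: real
  assumes "\<bar>x\<bar> \<le> 1"
  shows "cos x \<ge> 1 / 2"
proof -
  have "cos (pi / 3) \<le> cos \<bar>x\<bar>"
    using assms pi_gt3 by (intro cos_monotone_0_pi_le) auto
  then show ?thesis by (simp add: cos_60)
qed

text \<open>For such \<open>u\<close> all phases \<open>t * u\<close> lie in \<open>[-1, 1]\<close>,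
  where the cosine is at least 1/2; the bound is half of the area \<open>l / 2\<close> under the
  triangle.\<close>

lemma fejer_ge:
  assumes l: "l > 0" and u: "l * \<bar>u\<bar> \<le> 1"
  shows "fejer l u \<ge> l / 4"
proof -
  have "integral {0..l} (\<lambda>t. (1 - t / l) * (1 / 2)) \<le> fejer l u"
    unfolding fejer_def
  proof (rule integral_le[OF _ fejer_integrable])
    show "(\<lambda>t. (1 - t / l) * (1 / 2)) integrable_on {0..l}"
      using has_integral_mult_left[OF has_integral_one_minus[OF l]] by blast
    show "(1 - t / l) * (1 / 2) \<le> (1 - t / l) * cos (t * u)" if "t \<in> {0..l}" for t
    proof (rule mult_left_mono)
      have "\<bar>t * u\<bar> \<le> l * \<bar>u\<bar>" using that by (auto simp: abs_mult intro!: mult_right_mono)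
      then show "1 / 2 \<le> cos (t * u)" using u by (intro cos_ge_half) auto
    qed (use l that in \<open>auto simp: field_simps\<close>)
  qed
  also have "integral {0..l} (\<lambda>t. (1 - t / l) * (1 / 2)) = l / 4"
    using integral_unique[OF has_integral_mult_left[OF has_integral_one_minus[OF l], of "1/2"]] by simp
  finally show ?thesis .
qed

lemma fejer_one_le: "fejer 1 u \<le> 4 / (1 + u\<^sup>2)"
proof (cases "\<bar>u\<bar> \<le> 1")
  case True
  then have "u\<^sup>2 \<le> 1" by (simp add: abs_square_le_1)
  have "fejer 1 u \<le> 1" using fejer_le_half[of 1 u] by simp
  also have "0 < 1 + u\<^sup>2" by (simp add: add_pos_nonneg)
  then have "1 \<le> 4 / (1 + u\<^sup>2)" using \<open>u\<^sup>2 \<le> 1\<close> by (simp add: pos_le_divide_eq)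
  finally show ?thesis .
next
  case False
  then have "1 \<le> u\<^sup>2" using abs_le_square_iff[of 1 u] by simp
  have "fejer 1 u \<le> 2 / u\<^sup>2" using fejer_le[of 1 u] False by auto
  also have "\<dots> = 4 / (u\<^sup>2 + u\<^sup>2)" by simp
  also have "\<dots> \<le> 4 / (1 + u\<^sup>2)"
    using \<open>1 \<le> u\<^sup>2\<close> by (intro frac_le) auto
  finally show ?thesis .
qed

text \<open>The factor \<open>l\<close> in the denominator is the point: for fixed \<open>e\<close>,
  the kernel outside the window can be made as small as desired, while the weight
  \<open>1 / (1 + u\<^sup>2)\<close> keeps it summable over unit windows.\<close>

lemma fejer_tail_le:
  assumes l: "l > 0" and e: "0 < e" "e \<le> 1" and u: "\<bar>u\<bar> \<ge> e"
  shows "fejer l u \<le> 4 / (l * e\<^sup>2) / (1 + u\<^sup>2)"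
proof -
  have "u \<noteq> 0" using e u by auto
  have "e\<^sup>2 \<le> u\<^sup>2" using e u by (simp add: abs_le_square_iff[symmetric])
  moreover have "e\<^sup>2 * u\<^sup>2 \<le> 1 * u\<^sup>2"
    using e by (intro mult_right_mono) (auto simp: power_le_one)
  ultimately have *: "e\<^sup>2 * (1 + u\<^sup>2) \<le> 2 * u\<^sup>2" by (simp add: algebra_simps)
  have "fejer l u \<le> 2 / (l * u\<^sup>2)" using l \<open>u \<noteq> 0\<close> by (rule fejer_le)
  also have "\<dots> = 4 / (l * (2 * u\<^sup>2))" by simp
  also have "\<dots> \<le> 4 / (l * (e\<^sup>2 * (1 + u\<^sup>2)))"
    using * l e by (intro divide_left_mono mult_left_mono mult_pos_pos) (auto intro: add_pos_nonneg simp: \<open>u \<noteq> 0\<close>)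
  finally show ?thesis by (simp add: mult_ac)
qed

section \<open>The Riemann-Lebesgue lemma for continuously differentiable functions\<close>

lemma has_vector_derivative_cis_mult:
  "((\<lambda>t. cis (t * y)) has_vector_derivative (\<i> * of_real y * cis (t * y))) (at t within S)"
  unfolding has_vector_derivative_def
  by (auto intro!: derivative_eq_intros simp: scaleR_conv_of_real mult_ac)

text \<open>One integration by parts against \<open>cis (t * y)\<close> gains a factor
  \<open>1 / y\<close>, and all remaining terms are bounded.\<close>

lemma Riemann_Lebesgue_C1:
  fixes f f' :: "real \<Rightarrow> complex"
  assumes l: "0 \<le> l"
    and der: "\<And>t. t \<in> {0..l} \<Longrightarrow> (f has_vector_derivative f' t) (at t)"
    and cont: "continuous_on {0..l} f'"
  shows "((\<lambda>y. integral {0..l} (\<lambda>t. cis (t * y) * f t)) \<longlongrightarrow> 0) at_top"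
proof -
  have cf: "continuous_on {0..l} f"
    using der by (intro continuous_at_imp_continuous_on ballI) (auto intro: has_vector_derivative_continuous)
  have "bounded (f' ` {0..l})" by (intro compact_imp_bounded compact_continuous_image cont) auto
  then obtain B where B: "\<And>t. t \<in> {0..l} \<Longrightarrow> norm (f' t) \<le> B"
    unfolding bounded_iff by (meson imageI)
  have "norm (integral {0..l} (\<lambda>t. cis (t * y) * f t)) \<le> (norm (f l) + norm (f 0) + B * l) / y" if y: "y > 0" for y
  proof -
    let ?g = "\<lambda>t. cis (t * y) / (\<i> * of_real y)"
    have cg: "continuous_on {0..l} ?g"
      using y by (intro continuous_intros) auto
    define J where "J = integral {0..l} (\<lambda>t. ?g t * f' t)"
    have J: "((\<lambda>t. ?g t * f' t) has_integral J) {0..l}"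
      unfolding J_def by (intro integrable_integral integrable_continuous_real continuous_on_mult cg cont)
    have "norm J \<le> B / y * (l - 0)"
      unfolding J_def
    proof (rule integral_bound[OF l])
      show "norm (?g t * f' t) \<le> B / y" if "t \<in> {0..l}" for t
        using B[OF that] y by (simp add: norm_mult norm_divide divide_right_mono)
    qed (intro continuous_on_mult cg cont)
    have "((\<lambda>t. cis (t * y) * f t) has_integral (?g l * f l - ?g 0 * f 0 - J)) {0..l}"
    proof (rule integration_by_parts[where f = ?g and g = f and g' = f' and prod = "(*)"])
      show "(?g has_vector_derivative cis (t * y)) (at t)" for t
        using has_vector_derivative_divide[OF has_vector_derivative_cis_mult[of y t UNIV], of "\<i> * of_real y"] y
        by simp
    qed (use l cf cg der J in \<open>auto simp: bounded_bilinear_mult\<close>)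
    then have "norm (integral {0..l} (\<lambda>t. cis (t * y) * f t)) = norm (?g l * f l - ?g 0 * f 0 - J)"
      by (simp add: integral_unique)
    also have "\<dots> \<le> norm (?g l * f l) + norm (?g 0 * f 0) + norm J"
      by (meson norm_triangle_ineq4 order_trans add_mono order_refl)
    also have "\<dots> \<le> norm (f l) / y + norm (f 0) / y + B / y * l"
      using \<open>norm J \<le> _\<close> y by (simp add: norm_mult norm_divide)
    finally show ?thesis by (simp add: add_divide_distrib)
  qed
  then have "\<forall>\<^sub>F y in at_top. norm (integral {0..l} (\<lambda>t. cis (t * y) * f t)) \<le> (norm (f l) + norm (f 0) + B * l) / y"
    by (intro eventually_mono[OF eventually_gt_at_top[of "0::real"]])
  moreover have "((\<lambda>y. (norm (f l) + norm (f 0) + B * l) / y) \<longlongrightarrow> 0) at_top"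
    by real_asymp
  ultimately show ?thesis by (rule Lim_null_comparison)
qed

section \<open>Kernel averages as integrals along vertical lines\<close>

lemma fejer_sums:
  fixes b :: "nat \<Rightarrow> real" and D :: "real \<Rightarrow> complex"
  assumes l: "l > 0" and b: "summable (\<lambda>n. \<bar>b n\<bar>)"
    and D: "\<And>t. (\<lambda>n. of_real (b n) * cis (- t * ln (real n))) sums D t"
  shows "(\<lambda>n. b n * fejer l (y - ln (real n))) sums
           Re (integral {0..l} (\<lambda>t. cis (t * y) * (of_real (1 - t / l) * D t)))"
proof -
  let ?h = "\<lambda>n t. cis (t * y) * (of_real (1 - t / l) * (of_real (b n) * cis (- t * ln (real n))))"
  have hc: "continuous_on {0..l} (?h n)" for n
    using l by (intro continuous_intros) auto
  have hi: "?h n integrable_on {0..l}" for n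
    by (intro integrable_continuous_real hc)
  \<comment> \<open>Absolute summability of \<open>b\<close> makes the series uniformly convergent
    in \<open>t\<close>, which justifies exchanging sum and integral. This is why the exponent stays
    at \<open>a > 1\<close> until the very end.\<close>
  have "uniform_limit {0..l} (\<lambda>N t. \<Sum>n<N. ?h n t) (\<lambda>t. \<Sum>n. ?h n t) sequentially"
  proof (rule Weierstrass_m_test[OF _ b])
    fix n t assume "t \<in> {0..l}"
    then have "\<bar>1 - t / l\<bar> \<le> 1" using l by (auto simp: field_simps)
    then show "norm (?h n t) \<le> \<bar>b n\<bar>"
      unfolding norm_mult norm_cis norm_of_real by (simp add: mult_left_le_one_le)
  qed
  also have "(\<lambda>t. \<Sum>n. ?h n t) = (\<lambda>t. cis (t * y) * (of_real (1 - t / l) * D t))"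
    by (intro ext sums_unique[symmetric] sums_mult D)
  finally have ul: "uniform_limit {0..l} (\<lambda>N t. \<Sum>n<N. ?h n t)
      (\<lambda>t. cis (t * y) * (of_real (1 - t / l) * D t)) sequentially" .
  have "continuous_on {0..l} (\<lambda>t. \<Sum>n<N. ?h n t)" for N
    by (intro continuous_on_sum hc)
  from uniform_limit_integral[OF ul this]
  obtain I J where I: "\<And>N. ((\<lambda>t. \<Sum>n<N. ?h n t) has_integral I N) {0..l}"
      and J: "((\<lambda>t. cis (t * y) * (of_real (1 - t / l) * D t)) has_integral J) {0..l}"
      and lim: "I \<longlonglongrightarrow> J"
    by auto
  have "I = (\<lambda>N. \<Sum>n<N. integral {0..l} (?h n))"
    using integral_unique[OF I] hi by (auto simp: integral_sum)
  then have "(\<lambda>n. integral {0..l} (?h n)) sums J"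
    using lim by (simp add: sums_def)
  from sums_Re[OF this]
  have "(\<lambda>n. Re (integral {0..l} (?h n))) sums Re (integral {0..l} (\<lambda>t. cis (t * y) * (of_real (1 - t / l) * D t)))"
    using integral_unique[OF J] by simp
  moreover have "Re (integral {0..l} (?h n)) = b n * fejer l (y - ln (real n))" for n
  proof -
    have "Re (integral {0..l} (?h n)) = integral {0..l} (Re \<circ> ?h n)"
      using hi bounded_linear_Re by (rule integral_linear[symmetric])
    also have "Re \<circ> ?h n = (\<lambda>t. b n * ((1 - t / l) * cos (t * (y - ln (real n)))))"
    proof
      fix t
      show "(Re \<circ> ?h n) t = b n * ((1 - t / l) * cos (t * (y - ln (real n))))"
        by (simp add: right_diff_distrib cos_diff) (simp add: algebra_simps)
    qed
    finally show ?thesis by (simp add: fejer_def)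
  qed
  ultimately show ?thesis by simp
qed

lemma mangoldt_fejer_sums:
  assumes l: "l > 0" and a: "a > 1"
  shows "(\<lambda>n. (mangoldt n - 1) * real n powr (-a) * fejer l (y - ln (real n))) sums
    Re (integral {0..l} (\<lambda>t. cis (t * y) *
         (of_real (1 - t / l) * (mangoldt_series (Complex a t) - zeta_series (Complex a t)))))"
proof (rule fejer_sums[OF l])
  have sm: "summable (\<lambda>n. mangoldt n * real n powr (-a) + real n powr (-a))"
    using a by (intro summable_add summable_mangoldt_powr summable_nat_powr)
  have "\<bar>(mangoldt n - 1) * real n powr (-a)\<bar> \<le> mangoldt n * real n powr (-a) + real n powr (-a)" for n
  proof -
    have "\<bar>(mangoldt n - 1) * real n powr (-a)\<bar> = \<bar>mangoldt n - 1 :: real\<bar> * real n powr (-a)"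
      by (simp add: abs_mult)
    also have "\<dots> \<le> (mangoldt n + 1) * real n powr (-a)"
      using mangoldt_nonneg[of n] by (intro mult_right_mono) auto
    finally show ?thesis by (simp add: algebra_simps)
  qed
  then show "summable (\<lambda>n. \<bar>(mangoldt n - 1) * real n powr (-a)\<bar>)"
    by (intro summable_comparison_test'[OF sm, of 0]) (simp del: abs_mult)
  fix t
  have "(\<lambda>n. mangoldt n * of_nat n powr (- Complex a t) - of_nat n powr (- Complex a t)) sums
     (mangoldt_series (Complex a t) - zeta_series (Complex a t))"
    unfolding mangoldt_series_def zeta_series_def using a
    by (intro sums_diff summable_sums summable_norm_cancel[OF summable_norm_mangoldt_series]
          summable_norm_cancel[OF summable_norm_zeta_series]) auto
  also have "(\<lambda>n. mangoldt n * of_nat n powr (- Complex a t) - of_nat n powr (- Complex a t)) =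
     (\<lambda>n. of_real ((mangoldt n - 1) * real n powr (-a)) * cis (- t * ln (real n)))"
  proof
    fix n :: nat
    have "of_nat n powr (- Complex a t) = of_real (real n powr (-a)) * cis (- t * ln (real n))"
      by (rule nat_powr_Complex)
    then show "mangoldt n * of_nat n powr (- Complex a t) - of_nat n powr (- Complex a t) =
        of_real ((mangoldt n - 1) * real n powr (-a)) * cis (- t * ln (real n))"
      by (simp add: algebra_simps)
  qed
  finally show "(\<lambda>n. of_real ((mangoldt n - 1) * real n powr (-a)) * cis (- t * ln (real n))) sums
     (mangoldt_series (Complex a t) - zeta_series (Complex a t))" .
qed

text \<open>A compact segment of the zero-free line has a neighbourhood of uniform width inside the
  open set where \<open>zeta_reg\<close> is nonzero. This supplies a compact rectangle touching the
  line on which \<open>mangoldt_zeta_diff\<close> is uniformly continuous.\<close>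

lemma zeta_reg_nonzero_strip:
  obtains d where "d > 0" "\<And>a t. 1 \<le> a \<Longrightarrow> a \<le> 1 + d \<Longrightarrow> 0 \<le> t \<Longrightarrow> t \<le> l \<Longrightarrow> zeta_reg (Complex a t) \<noteq> 0"
proof -
  let ?U = "{s. Re s > 0 \<and> zeta_reg s \<noteq> 0}" and ?K = "Complex 1 ` {0..l}"
  have "compact ?K"
    unfolding Complex_eq by (intro compact_continuous_image continuous_intros) auto
  moreover have "?K \<subseteq> ?U" by (auto simp: zeta_reg_nonzero)
  ultimately obtain e where e: "e > 0" "(\<Union>x\<in>?K. ball x e) \<subseteq> ?U"
    using compact_subset_open_imp_ball_epsilon_subset[OF _ open_zeta_reg_nonzero] by blast
  show ?thesis
  proof (rule that[of "e / 2"])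
    fix a t assume at: "1 \<le> a" "a \<le> 1 + e / 2" "0 \<le> t" "t \<le> l"
    have "Complex 1 t - Complex a t = of_real (1 - a)" by (simp add: complex_eq_iff)
    then have "dist (Complex 1 t) (Complex a t) = \<bar>1 - a\<bar>"
      unfolding dist_norm by (simp only: norm_of_real)
    then have "Complex a t \<in> ball (Complex 1 t) e" using at e(1) by auto
    then have "Complex a t \<in> ?U" using e(2) at by (meson UN_I atLeastAtMost_iff image_eqI subsetD)
    then show "zeta_reg (Complex a t) \<noteq> 0" by blast
  qed (use e in auto)
qed

lemma mangoldt_zeta_diff_continuous_on:
  assumes "\<And>a t. 1 \<le> a \<Longrightarrow> a \<le> 1 + d \<Longrightarrow> 0 \<le> t \<Longrightarrow> t \<le> l \<Longrightarrow> zeta_reg (Complex a t) \<noteq> 0"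
  shows "continuous_on ({1..1+d} \<times> {0..l}) (\<lambda>p. mangoldt_zeta_diff (Complex (fst p) (snd p)))"
proof (rule continuous_on_compose2[OF holomorphic_on_imp_continuous_on[OF mangoldt_zeta_diff_holomorphic]])
  show "continuous_on ({1..1+d} \<times> {0..l}) (\<lambda>p. Complex (fst p) (snd p))"
    unfolding Complex_eq by (intro continuous_intros)
qed (use assms in auto)

definition mangoldt_fejer_diff :: "real \<Rightarrow> real \<Rightarrow> real \<Rightarrow> real" where
  "mangoldt_fejer_diff l a y = (\<Sum>n. (mangoldt n - 1) * real n powr (-a) * fejer l (y - ln (real n)))"

lemma mangoldt_fejer_diff_eq:
  assumes l: "l > 0" and a: "a > 1" and nz: "\<And>t. 0 \<le> t \<Longrightarrow> t \<le> l \<Longrightarrow> zeta_reg (Complex a t) \<noteq> 0"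
  shows "mangoldt_fejer_diff l a y =
    Re (integral {0..l} (\<lambda>t. cis (t * y) * (of_real (1 - t / l) * mangoldt_zeta_diff (Complex a t))))"
proof -
  have "integral {0..l} (\<lambda>t. cis (t * y) *
         (of_real (1 - t / l) * (mangoldt_series (Complex a t) - zeta_series (Complex a t)))) =
     integral {0..l} (\<lambda>t. cis (t * y) * (of_real (1 - t / l) * mangoldt_zeta_diff (Complex a t)))"
    using a nz by (intro integral_cong) (simp add: mangoldt_zeta_diff_eq)
  with sums_unique[OF mangoldt_fejer_sums[OF l a, of y]] show ?thesis
    by (simp add: mangoldt_fejer_diff_def)
qed

lemma norm_fejer_integrand_le:
  assumes "0 \<le> t" "t \<le> l" "norm z \<le> B"
  shows "norm (cis (t * y) * (of_real (1 - t / l) * z)) \<le> B"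
proof -
  have "\<bar>1 - t / l\<bar> \<le> 1" using assms by (cases "l = 0") (auto simp: field_simps)
  then have "\<bar>1 - t / l\<bar> * norm z \<le> norm z" by (intro mult_left_le_one_le) auto
  then show ?thesis using assms(3) by (simp add: norm_mult del: of_real_diff)
qed

text \<open>The bound is uniform in both \<open>a\<close> and \<open>y\<close>, since
  \<open>y\<close> enters the integral only through the unimodular factor
  \<open>cis (t * y)\<close>. Uniformity in \<open>a\<close> survives the passage to
  \<open>a = 1\<close>.\<close>

lemma mangoldt_fejer_diff_bounded:
  assumes l: "l > 0"
  obtains d C where "d > 0" "\<And>a y. 1 < a \<Longrightarrow> a \<le> 1 + d \<Longrightarrow> \<bar>mangoldt_fejer_diff l a y\<bar> \<le> C"
proof -
  obtain d where d: "d > 0"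
    "\<And>a t. 1 \<le> a \<Longrightarrow> a \<le> 1 + d \<Longrightarrow> 0 \<le> t \<Longrightarrow> t \<le> l \<Longrightarrow> zeta_reg (Complex a t) \<noteq> 0"
    using zeta_reg_nonzero_strip by blast
  let ?F = "\<lambda>p. mangoldt_zeta_diff (Complex (fst p) (snd p))" and ?R = "{1..1+d} \<times> {0..l}"
  have cont: "continuous_on ?R ?F" by (rule mangoldt_zeta_diff_continuous_on[OF d(2)])
  have "bounded (?F ` ?R)"
    by (intro compact_imp_bounded compact_continuous_image cont compact_Times) auto
  then obtain B where B: "\<And>p. p \<in> ?R \<Longrightarrow> norm (?F p) \<le> B"
    unfolding bounded_iff by (meson imageI)
  have "\<bar>mangoldt_fejer_diff l a y\<bar> \<le> B * (l - 0)" if a: "1 < a" "a \<le> 1 + d" for a y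
  proof -
    have "continuous_on {0..l} (\<lambda>t. ?F (a, t))"
      by (rule continuous_on_compose2[OF cont]) (use a in \<open>auto intro!: continuous_intros\<close>)
    then have c: "continuous_on {0..l} (\<lambda>t. mangoldt_zeta_diff (Complex a t))" by simp
    have n: "norm (integral {0..l} (\<lambda>t. cis (t * y) * (of_real (1 - t / l) * mangoldt_zeta_diff (Complex a t)))) \<le> B * (l - 0)"
    proof (rule integral_bound)
      show "norm (cis (t * y) * (of_real (1 - t / l) * mangoldt_zeta_diff (Complex a t))) \<le> B"
        if "t \<in> {0..l}" for t
        using that a B[of "(a, t)"] by (intro norm_fejer_integrand_le) auto
    qed (use l c in \<open>auto intro!: continuous_intros\<close>)
    have eq: "mangoldt_fejer_diff l a y =
      Re (integral {0..l} (\<lambda>t. cis (t * y) * (of_real (1 - t / l) * mangoldt_zeta_diff (Complex a t))))"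
      using a d(2) by (intro mangoldt_fejer_diff_eq l) auto
    show ?thesis unfolding eq by (rule order_trans[OF abs_Re_le_cmod n])
  qed
  with d(1) that show ?thesis by blast
qed

lemma mangoldt_zeta_diff_boundary_tendsto:
  assumes l: "l > 0"
  shows "((\<lambda>y. integral {0..l} (\<lambda>t. cis (t * y) * (of_real (1 - t / l) * mangoldt_zeta_diff (Complex 1 t)))) \<longlongrightarrow> 0) at_top"
proof (rule Riemann_Lebesgue_C1)
  let ?U = "{s. Re s > 0 \<and> zeta_reg s \<noteq> 0}"
  have path: "((\<lambda>t. Complex 1 t) has_vector_derivative \<i>) (at t)" for t
    unfolding Complex_eq by (auto intro!: derivative_eq_intros simp: has_vector_derivative_def scaleR_conv_of_real)
  have U: "Complex 1 t \<in> ?U" for t by (simp add: zeta_reg_nonzero)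
  let ?f' = "\<lambda>t. of_real (1 - t / l) * (\<i> * deriv mangoldt_zeta_diff (Complex 1 t)) +
      of_real (- 1 / l) * mangoldt_zeta_diff (Complex 1 t)"
  fix t
  have "(mangoldt_zeta_diff has_field_derivative deriv mangoldt_zeta_diff (Complex 1 t)) (at (Complex 1 t))"
    using U by (intro holomorphic_derivI[OF mangoldt_zeta_diff_holomorphic open_zeta_reg_nonzero])
  from field_vector_diff_chain_at[OF path this]
  have 1: "((\<lambda>t. mangoldt_zeta_diff (Complex 1 t)) has_vector_derivative
      \<i> * deriv mangoldt_zeta_diff (Complex 1 t)) (at t)"
    by (simp add: o_def)
  have "((\<lambda>t. 1 - t / l) has_real_derivative (- 1 / l)) (at t)"
    using l by (auto intro!: derivative_eq_intros)
  then have 2: "((\<lambda>t. of_real (1 - t / l) :: complex) has_vector_derivative of_real (- 1 / l)) (at t)"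
    by (rule has_vector_derivative_of_real)
  show "((\<lambda>t. of_real (1 - t / l) * mangoldt_zeta_diff (Complex 1 t)) has_vector_derivative ?f' t) (at t)"
    by (rule has_vector_derivative_mult[OF 2 1])
next
  let ?U = "{s. Re s > 0 \<and> zeta_reg s \<noteq> 0}"
  let ?f' = "\<lambda>t. of_real (1 - t / l) * (\<i> * deriv mangoldt_zeta_diff (Complex 1 t)) +
      of_real (- 1 / l) * mangoldt_zeta_diff (Complex 1 t)"
  have cp: "continuous_on {0..l} (\<lambda>t. Complex 1 t)"
    unfolding Complex_eq by (intro continuous_intros)
  have U: "Complex 1 ` {0..l} \<subseteq> ?U" by (auto simp: zeta_reg_nonzero)
  have "continuous_on {0..l} (\<lambda>t. deriv mangoldt_zeta_diff (Complex 1 t))"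
    using mangoldt_zeta_diff_holomorphic open_zeta_reg_nonzero
    by (intro continuous_on_compose2[OF holomorphic_on_imp_continuous_on[OF holomorphic_deriv] cp U])
  moreover have "continuous_on {0..l} (\<lambda>t. mangoldt_zeta_diff (Complex 1 t))"
    by (rule continuous_on_compose2[OF holomorphic_on_imp_continuous_on[OF mangoldt_zeta_diff_holomorphic] cp U])
  ultimately show "continuous_on {0..l} ?f'"
    using l by (intro continuous_intros) auto
qed (use l in auto)

text \<open>\<open>d\<close> and \<open>Y\<close> are independent of each other's variables, so
  \<open>a\<close> may tend to 1 with \<open>y\<close> fixed. Uniform continuity replaces
  \<open>a\<close> by 1 at cost \<open>e / 2\<close>, that is \<open>e / (2 * l)\<close> pointwise
  over length \<open>l\<close>; the boundary integral costs the other \<open>e / 2\<close>.\<close>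

lemma mangoldt_fejer_diff_small:
  assumes l: "l > 0" and e: "e > 0"
  obtains d Y where "d > 0" "\<And>a y. 1 < a \<Longrightarrow> a \<le> 1 + d \<Longrightarrow> y \<ge> Y \<Longrightarrow> \<bar>mangoldt_fejer_diff l a y\<bar> \<le> e"
proof -
  obtain d where d: "d > 0"
    "\<And>a t. 1 \<le> a \<Longrightarrow> a \<le> 1 + d \<Longrightarrow> 0 \<le> t \<Longrightarrow> t \<le> l \<Longrightarrow> zeta_reg (Complex a t) \<noteq> 0"
    using zeta_reg_nonzero_strip by blast
  let ?F = "\<lambda>p. mangoldt_zeta_diff (Complex (fst p) (snd p))" and ?R = "{1..1+d} \<times> {0..l}"
  let ?I = "\<lambda>a y. integral {0..l} (\<lambda>t. cis (t * y) * (of_real (1 - t / l) * mangoldt_zeta_diff (Complex a t)))"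
  have cont: "continuous_on ?R ?F" by (rule mangoldt_zeta_diff_continuous_on[OF d(2)])
  have c: "continuous_on {0..l} (\<lambda>t. mangoldt_zeta_diff (Complex a t))" if "1 \<le> a" "a \<le> 1 + d" for a
  proof -
    have "continuous_on {0..l} (\<lambda>t. ?F (a, t))"
      by (rule continuous_on_compose2[OF cont]) (use that in \<open>auto intro!: continuous_intros\<close>)
    then show ?thesis by simp
  qed
  have "uniformly_continuous_on ?R ?F"
    by (intro compact_uniformly_continuous cont compact_Times) auto
  moreover have "e / (2 * l) > 0" using l e by simp
  ultimately obtain d' where d': "d' > 0"
    "\<And>p q. p \<in> ?R \<Longrightarrow> q \<in> ?R \<Longrightarrow> dist q p < d' \<Longrightarrow> dist (?F q) (?F p) < e / (2 * l)"
    unfolding uniformly_continuous_on_def by meson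
  have "\<forall>\<^sub>F y in at_top. dist (?I 1 y) 0 < e / 2"
    using mangoldt_zeta_diff_boundary_tendsto[OF l] e by (intro tendstoD) auto
  then obtain Y where Y: "\<And>y. y \<ge> Y \<Longrightarrow> norm (?I 1 y) < e / 2"
    by (auto simp: eventually_at_top_linorder)
  show ?thesis
  proof (rule that[of "min d (d' / 2)" Y])
    fix a y assume a: "1 < a" "a \<le> 1 + min d (d' / 2)" and y: "y \<ge> Y"
    have "norm (?I a y - ?I 1 y) \<le> e / (2 * l) * (l - 0)"
    proof -
      have "?I a y - ?I 1 y = integral {0..l} (\<lambda>t. cis (t * y) * (of_real (1 - t / l) *
          (mangoldt_zeta_diff (Complex a t) - mangoldt_zeta_diff (Complex 1 t))))"
        using l a d(1) c[of a] c[of 1]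
        by (subst integral_diff[symmetric])
           (auto intro!: integrable_continuous_real continuous_intros simp: algebra_simps)
      also have "norm \<dots> \<le> e / (2 * l) * (l - 0)"
      proof (rule integral_bound)
        fix t assume t: "t \<in> {0..l}"
        have "dist (?F (a, t)) (?F (1, t)) < e / (2 * l)"
          using t a d(1) d'(1) by (intro d'(2)) (auto simp: dist_Pair_Pair dist_real_def)
        then show "norm (cis (t * y) * (of_real (1 - t / l) *
          (mangoldt_zeta_diff (Complex a t) - mangoldt_zeta_diff (Complex 1 t)))) \<le> e / (2 * l)"
          using t by (intro norm_fejer_integrand_le) (auto simp: dist_norm)
      qed (use l a d(1) c[of a] c[of 1] in \<open>auto intro!: continuous_intros\<close>)
      finally show ?thesis .
    qed
    also have "e / (2 * l) * (l - 0) = e / 2" using l by simp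
    finally have n: "norm (?I a y) \<le> e"
      using Y[OF y] norm_triangle_sub[of "?I a y" "?I 1 y"] by linarith
    have eq: "mangoldt_fejer_diff l a y = Re (?I a y)"
      using a d(2) by (intro mangoldt_fejer_diff_eq l) auto
    show "\<bar>mangoldt_fejer_diff l a y\<bar> \<le> e"
      unfolding eq by (rule order_trans[OF abs_Re_le_cmod n])
  qed (use d(1) d'(1) in auto)
qed

section \<open>Primes in short intervals\<close>

text \<open>The integers between \<open>exp (y - r)\<close> and \<open>exp (y + r)\<close>.
  Positivity is imposed because \<open>ln 0 = 0\<close> would otherwise let 0 into windows around
  small \<open>y\<close>.\<close>

definition log_window :: "real \<Rightarrow> real \<Rightarrow> nat set" where
  "log_window y r = {n. n > 0 \<and> \<bar>y - ln (real n)\<bar> \<le> r}"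

lemma log_window_le:
  assumes "n \<in> log_window y r"
  shows "real n \<le> exp (y + r)"
proof -
  have "n > 0" "ln (real n) \<le> y + r" using assms by (auto simp: log_window_def)
  then show ?thesis by (metis exp_le_cancel_iff exp_ln of_nat_0_less_iff)
qed

lemma log_window_ge:
  assumes "n \<in> log_window y r"
  shows "real n \<ge> exp (y - r)"
proof -
  have "n > 0" "y - r \<le> ln (real n)" using assms by (auto simp: log_window_def)
  then show ?thesis by (metis exp_le_cancel_iff exp_ln of_nat_0_less_iff)
qed

lemma finite_log_window [simp]: "finite (log_window y r)"
proof (rule finite_subset)
  show "log_window y r \<subseteq> {..nat \<lfloor>exp (y + r)\<rfloor>}"
    using log_window_le by (auto simp: le_nat_floor)
qed auto

lemma sum_inverse_log_window_le:
  "(\<Sum>n\<in>log_window y (1/2). 1 / real n) \<le> 3"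
proof -
  have "log_window y (1/2) \<subseteq> {1..nat \<lfloor>exp (y + 1/2)\<rfloor>}"
    using log_window_le by (auto simp: le_nat_floor log_window_def)
  then have "card (log_window y (1/2)) \<le> card {1..nat \<lfloor>exp (y + 1/2)\<rfloor>}"
    by (intro card_mono) auto
  then have "card (log_window y (1/2)) \<le> nat \<lfloor>exp (y + 1/2)\<rfloor>" by simp
  then have "real (card (log_window y (1/2))) \<le> real (nat \<lfloor>exp (y + 1/2)\<rfloor>)" by (rule of_nat_mono)
  also have "\<dots> \<le> exp (y + 1/2)" by (rule of_nat_floor) auto
  finally have card: "real (card (log_window y (1/2))) \<le> exp (y + 1/2)" .
  have "(\<Sum>n\<in>log_window y (1/2). 1 / real n) \<le> (\<Sum>n\<in>log_window y (1/2). 1 / exp (y - 1/2))"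
    using log_window_ge by (intro sum_mono divide_left_mono) (auto simp: log_window_def)
  also have "\<dots> = real (card (log_window y (1/2))) / exp (y - 1/2)" by simp
  also have "\<dots> \<le> exp (y + 1/2) / exp (y - 1/2)"
    using card by (intro divide_right_mono) auto
  also have "\<dots> = exp 1" by (simp flip: exp_diff)
  also have "\<dots> \<le> 3" by (rule exp_le)
  finally show ?thesis .
qed

lemma sum_inverse_one_plus_square_le:
  assumes "finite (M :: int set)"
  shows "(\<Sum>m\<in>M. 1 / (1 + (real_of_int m)\<^sup>2)) \<le> 5"
proof -
  \<comment> \<open>An equality for \<open>N = 0\<close>. The correction
    \<open>4 / (real N + 1)\<close> is chosen to telescope: each new pair of terms is at most the
    difference of consecutive corrections.\<close>
  have *: "(\<Sum>m\<in>{-int N..int N}. 1 / (1 + (real_of_int m)\<^sup>2)) \<le> 5 - 4 / (real N + 1)" for N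
  proof (induction N)
    case (Suc N)
    have eq: "{-int (Suc N)..int (Suc N)} = insert (int (Suc N)) (insert (-int (Suc N)) {-int N..int N})"
      by auto
    have "(\<Sum>m\<in>{-int (Suc N)..int (Suc N)}. 1 / (1 + (real_of_int m)\<^sup>2)) =
       2 / (1 + (real N + 1)\<^sup>2) + (\<Sum>m\<in>{-int N..int N}. 1 / (1 + (real_of_int m)\<^sup>2))"
      unfolding eq by (simp add: power2_eq_square algebra_simps)
    also have "2 / (1 + (real N + 1)\<^sup>2) \<le> 4 / ((real N + 1) * (real N + 2))"
    proof -
      have "2 / (1 + (real N + 1)\<^sup>2) = 4 / (2 * (1 + (real N + 1)\<^sup>2))"
        using mult_divide_mult_cancel_left[of 2 2 "1 + (real N + 1)\<^sup>2"] by simp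
      also have "\<dots> \<le> 4 / ((real N + 1) * (real N + 2))"
        by (intro divide_left_mono mult_pos_pos) (auto simp: power2_eq_square algebra_simps add_pos_nonneg)
      finally show ?thesis .
    qed
    also have "\<dots> = 4 / (real N + 1) - 4 / (real (Suc N) + 1)"
      by (simp add: divide_simps)
    finally show ?case using Suc.IH by simp
  qed auto
  obtain N where "M \<subseteq> {-int N..int N}"
  proof -
    obtain B where "\<forall>m\<in>M. \<bar>m\<bar> \<le> B" 
      using bdd_above_finite[of "abs ` M"] assms unfolding bdd_above_def by blast
    then have "M \<subseteq> {-int (nat B)..int (nat B)}" by (auto simp: abs_le_iff)
    then show ?thesis using that by blast
  qed
  then have "(\<Sum>m\<in>M. 1 / (1 + (real_of_int m)\<^sup>2)) \<le> (\<Sum>m\<in>{-int N..int N}. 1 / (1 + (real_of_int m)\<^sup>2))"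
    by (intro sum_mono2) (auto intro: add_nonneg_nonneg)
  also have "\<dots> \<le> 5 - 4 / (real N + 1)" by (rule *)
  also have "\<dots> \<le> 5" by simp
  finally show ?thesis .
qed

text \<open>Indices are grouped by \<open>m = \<lfloor>ln (real n) - y\<rfloor>\<close>. Each group
  lies in one window of radius 1/2 centred at \<open>y + m + 1/2\<close>, and there the weight is at
  most \<open>3 / (1 + m\<^sup>2)\<close>; the sum over \<open>m\<close> contributes 5.\<close>

lemma sum_weighted_le:
  fixes b :: "nat \<Rightarrow> real"
  assumes nonneg: "\<And>n. b n \<ge> 0"
    and C: "\<And>y. (\<Sum>n\<in>log_window y (1/2). b n) \<le> C"
    and A: "finite A" "0 \<notin> A"
  shows "(\<Sum>n\<in>A. b n / (1 + (y - ln (real n))\<^sup>2)) \<le> 15 * C"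
proof -
  define f where "f n = \<lfloor>ln (real n) - y\<rfloor>" for n :: nat
  have "0 \<le> (\<Sum>n\<in>log_window y (1/2). b n)" by (intro sum_nonneg nonneg)
  with C[of y] have C0: "C \<ge> 0" by linarith
  have "(\<Sum>n\<in>A. b n / (1 + (y - ln (real n))\<^sup>2)) =
     (\<Sum>m\<in>f ` A. \<Sum>n | n \<in> A \<and> f n = m. b n / (1 + (y - ln (real n))\<^sup>2))"
    using A by (subst sum.group) auto
  also have "\<dots> \<le> (\<Sum>m\<in>f ` A. 3 * C * (1 / (1 + (real_of_int m)\<^sup>2)))"
  proof (rule sum_mono)
    fix m
    have "(\<Sum>n | n \<in> A \<and> f n = m. b n / (1 + (y - ln (real n))\<^sup>2)) \<le>
        (\<Sum>n | n \<in> A \<and> f n = m. b n * (3 / (1 + (real_of_int m)\<^sup>2)))"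
    proof (rule sum_mono)
      fix n assume "n \<in> {n. n \<in> A \<and> f n = m}"
      define u where "u = y - ln (real n)"
      have "\<bar>real_of_int m\<bar> \<le> \<bar>u\<bar> + 1"
        using \<open>n \<in> _\<close> unfolding f_def u_def by simp linarith
      then have "\<bar>real_of_int m\<bar>\<^sup>2 \<le> (\<bar>u\<bar> + 1)\<^sup>2" by (intro power_mono) auto
      also have "(\<bar>u\<bar> + 1)\<^sup>2 \<le> 2 * u\<^sup>2 + 2"
        using zero_le_power2[of "\<bar>u\<bar> - 1"] by (simp add: power2_eq_square algebra_simps)
      also have "\<dots> \<le> 3 * u\<^sup>2 + 2" by simp
      finally have "1 + (real_of_int m)\<^sup>2 \<le> 1 + (3 * u\<^sup>2 + 2)" by simp
      also have "\<dots> = 3 * (1 + u\<^sup>2)" by simp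
      finally have "1 + (real_of_int m)\<^sup>2 \<le> 3 * (1 + u\<^sup>2)" .
      moreover have "0 < 1 + (real_of_int m)\<^sup>2" "0 < 1 + u\<^sup>2" by (auto intro: add_pos_nonneg)
      ultimately have "1 / (1 + u\<^sup>2) \<le> 3 / (1 + (real_of_int m)\<^sup>2)"
        by (simp add: field_simps)
      then have "b n * (1 / (1 + u\<^sup>2)) \<le> b n * (3 / (1 + (real_of_int m)\<^sup>2))"
        by (rule mult_left_mono) (rule nonneg)
      then show "b n / (1 + (y - ln (real n))\<^sup>2) \<le> b n * (3 / (1 + (real_of_int m)\<^sup>2))"
        by (simp add: u_def)
    qed
    also have "\<dots> = (\<Sum>n | n \<in> A \<and> f n = m. b n) * (3 / (1 + (real_of_int m)\<^sup>2))"
      by (simp only: sum_distrib_right)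
    also have "(\<Sum>n | n \<in> A \<and> f n = m. b n) \<le> (\<Sum>n\<in>log_window (y + m + 1/2) (1/2). b n)"
    proof (rule sum_mono2)
      show "{n. n \<in> A \<and> f n = m} \<subseteq> log_window (y + m + 1/2) (1/2)"
      proof
        fix n assume n: "n \<in> {n. n \<in> A \<and> f n = m}"
        then have "n > 0" using A(2) by (auto intro: Nat.gr0I)
        moreover have "real_of_int m \<le> ln (real n) - y" "ln (real n) - y < real_of_int m + 1"
          using n unfolding f_def by (auto simp: floor_eq_iff)
        then have "\<bar>(y + m + 1/2) - ln (real n)\<bar> \<le> 1/2"
          unfolding abs_le_iff by linarith
        ultimately show "n \<in> log_window (y + m + 1/2) (1/2)" by (simp add: log_window_def)
      qed
    qed (auto simp: nonneg)
    also have "\<dots> \<le> C" by (rule C)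
    finally show "(\<Sum>n | n \<in> A \<and> f n = m. b n / (1 + (y - ln (real n))\<^sup>2)) \<le> 3 * C * (1 / (1 + (real_of_int m)\<^sup>2))"
      by (simp add: mult_right_mono divide_right_mono mult_ac)
  qed
  also have "\<dots> = 3 * C * (\<Sum>m\<in>f ` A. 1 / (1 + (real_of_int m)\<^sup>2))"
    by (simp add: sum_distrib_left)
  also have "\<dots> \<le> 3 * C * 5"
    using A C0 by (intro mult_left_mono sum_inverse_one_plus_square_le) auto
  finally show ?thesis by simp
qed

section \<open>Comparing window sums with kernel averages\<close>

lemma summable_powr_fejer:
  fixes b :: "nat \<Rightarrow> real"
  assumes l: "l > 0" and b: "\<And>n. b n \<ge> 0" "summable (\<lambda>n. b n * real n powr (-a))"
  shows "summable (\<lambda>n. b n * real n powr (-a) * fejer l (y - ln (real n)))"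
proof (rule summable_comparison_test'[of _ 0])
  show "summable (\<lambda>n. b n * real n powr (-a) * (l / 2))"
    using b(2) by (rule summable_mult2)
  fix n
  have "0 \<le> b n * real n powr (-a)" using b(1)[of n] by simp
  then show "norm (b n * real n powr (-a) * fejer l (y - ln (real n))) \<le> b n * real n powr (-a) * (l / 2)"
    using mult_left_mono[OF fejer_le_half[OF l, of "y - ln (real n)"]]
      mult_nonneg_nonneg[OF _ fejer_nonneg[OF l, of "y - ln (real n)"]]
    by (simp only: real_norm_def abs_of_nonneg)
qed

lemma mangoldt_fejer_diff_split:
  assumes l: "l > 0" and a: "a > 1"
  shows "mangoldt_fejer_diff l a y =
      (\<Sum>n. mangoldt n * real n powr (-a) * fejer l (y - ln (real n)))
    - (\<Sum>n. real n powr (-a) * fejer l (y - ln (real n)))"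
proof -
  have "summable (\<lambda>n. mangoldt n * real n powr (-a) * fejer l (y - ln (real n)))"
    using a by (intro summable_powr_fejer l mangoldt_nonneg summable_mangoldt_powr)
  moreover have "summable (\<lambda>n. 1 * real n powr (-a) * fejer l (y - ln (real n)))"
    using a summable_nat_powr[of a] by (intro summable_powr_fejer l) auto
  ultimately show ?thesis
    unfolding mangoldt_fejer_diff_def by (subst suminf_diff) (auto simp: algebra_simps)
qed

lemma sum_powr_tendsto:
  fixes c :: "nat \<Rightarrow> real"
  shows "((\<lambda>a. \<Sum>n\<in>log_window y r. c n * real n powr (-a)) \<longlongrightarrow> (\<Sum>n\<in>log_window y r. c n / real n)) (at_right 1)"
proof (intro tendsto_sum)
  fix n assume "n \<in> log_window y r"
  then have n: "real n > 0" by (auto simp: log_window_def)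
  have "((\<lambda>a. c n * real n powr (-a)) \<longlongrightarrow> c n * real n powr (-1)) (at_right 1)"
    using n by (intro tendsto_intros) auto
  then show "((\<lambda>a. c n * real n powr (-a)) \<longlongrightarrow> c n / real n) (at_right 1)"
    using n by (simp add: powr_minus_divide)
qed

lemma suminf_le_of_finite_sums:
  fixes f :: "nat \<Rightarrow> real"
  assumes "summable f" "f 0 = 0" "\<And>A. finite A \<Longrightarrow> 0 \<notin> A \<Longrightarrow> sum f A \<le> C"
  shows "suminf f \<le> C"
proof (rule suminf_le_const[OF assms(1)])
  fix N
  have "sum f {..<N} = sum f ({..<N} - {0})"
    by (rule sum.mono_neutral_right) (auto simp: assms(2))
  also have "\<dots> \<le> C" by (rule assms(3)) auto
  finally show "sum f {..<N} \<le> C" .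
qed

lemma nat_powr_minus_le:
  assumes "a \<ge> 1"
  shows "real n powr (-a) \<le> 1 / real n"
proof (cases "n = 0")
  case False
  then have "real n powr (-a) \<le> real n powr (-1)" using assms by (intro powr_mono) auto
  then show ?thesis using False by (simp add: powr_minus_divide)
qed auto

text \<open>A Chebyshev-type bound. The kernel of parameter 1 is at least 1/4 on the window, hence
  the factor 4; its average of \<open>1 / n\<close> is at most \<open>180 = 4 * 15 * 3\<close>, and
  the two averages differ by at most the inner \<open>C\<close>. Only finitely many terms remain
  when \<open>a\<close> tends to 1.\<close>

theorem mangoldt_window_bound:
  obtains C where "\<And>y. (\<Sum>n\<in>log_window y (1/2). mangoldt n / real n) \<le> C"
proof -
  obtain d C where d: "d > 0" "\<And>a y. 1 < a \<Longrightarrow> a \<le> 1 + d \<Longrightarrow> \<bar>mangoldt_fejer_diff 1 a y\<bar> \<le> C"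
    using mangoldt_fejer_diff_bounded[of 1] by auto
  have "(\<Sum>n\<in>log_window y (1/2). mangoldt n / real n) \<le> 4 * (C + 180)" for y
  proof (rule tendsto_upperbound[OF sum_powr_tendsto])
    have "\<forall>\<^sub>F a in at_right (1::real). a \<in> {1<..<1+d}"
      using d(1) by (intro eventually_at_right_field[THEN iffD2] exI[of _ "1+d"]) auto
    then show "\<forall>\<^sub>F a in at_right 1. (\<Sum>n\<in>log_window y (1/2). mangoldt n * real n powr (-a)) \<le> 4 * (C + 180)"
    proof eventually_elim
      case (elim a)
      then have a: "a > 1" by auto
      let ?f = "\<lambda>n. mangoldt n * real n powr (-a) * fejer 1 (y - ln (real n))"
      let ?g = "\<lambda>n. real n powr (-a) * fejer 1 (y - ln (real n))"
      have sf: "summable ?f"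
        using a by (intro summable_powr_fejer mangoldt_nonneg summable_mangoldt_powr) auto
      have sg: "summable ?g"
        using a summable_powr_fejer[of 1 "\<lambda>_. 1" a y] summable_nat_powr[of a] by simp
      have "suminf ?g \<le> 180"
      proof (rule suminf_le_of_finite_sums[OF sg])
        fix A :: "nat set" assume A: "finite A" "0 \<notin> A"
        have "sum ?g A \<le> (\<Sum>n\<in>A. 4 * ((1 / real n) / (1 + (y - ln (real n))\<^sup>2)))"
        proof (rule sum_mono)
          fix n
          have "?g n \<le> (1 / real n) * (4 / (1 + (y - ln (real n))\<^sup>2))"
            using a by (intro mult_mono nat_powr_minus_le fejer_one_le fejer_nonneg) auto
          then show "?g n \<le> 4 * ((1 / real n) / (1 + (y - ln (real n))\<^sup>2))" by (simp add: mult_ac)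
        qed
        also have "\<dots> = 4 * (\<Sum>n\<in>A. (1 / real n) / (1 + (y - ln (real n))\<^sup>2))"
          by (simp add: sum_distrib_left)
        also have "\<dots> \<le> 4 * (15 * 3)"
          using A by (intro mult_left_mono sum_weighted_le sum_inverse_log_window_le) auto
        finally show "sum ?g A \<le> 180" by simp
      qed auto
      moreover have "suminf ?f - suminf ?g \<le> C"
        using d(2)[of a y] elim mangoldt_fejer_diff_split[of 1 a y] by auto
      ultimately have "suminf ?f \<le> C + 180" by linarith
      have "(\<Sum>n\<in>log_window y (1/2). mangoldt n * real n powr (-a)) \<le> (\<Sum>n\<in>log_window y (1/2). 4 * ?f n)"
      proof (rule sum_mono)
        fix n assume "n \<in> log_window y (1/2)"
        then have "fejer 1 (y - ln (real n)) \<ge> 1 / 4"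
          by (intro fejer_ge) (auto simp: log_window_def)
        then have "mangoldt n * real n powr (-a) * (1/4) \<le> ?f n"
          by (intro mult_left_mono mult_nonneg_nonneg mangoldt_nonneg) auto
        then show "mangoldt n * real n powr (-a) \<le> 4 * ?f n" by simp
      qed
      also have "\<dots> = 4 * (\<Sum>n\<in>log_window y (1/2). ?f n)" by (simp add: sum_distrib_left)
      also have "(\<Sum>n\<in>log_window y (1/2). ?f n) \<le> suminf ?f"
        using sf by (intro sum_le_suminf) (auto intro!: mult_nonneg_nonneg mangoldt_nonneg fejer_nonneg)
      also note \<open>suminf ?f \<le> C + 180\<close>
      finally show ?case by simp
    qed
  qed auto
  then show ?thesis using that by blast
qed

text \<open>With endpoints \<open>A < B\<close>, at least \<open>B - A - 1\<close> integers
  contribute at least \<open>1 / B\<close> each. The rounding loss \<open>1 / B\<close> is at most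
  \<open>exp (-y)\<close>, and \<open>A / B = exp (-2 / l)\<close> is at most
  \<open>1 - 1 / l\<close> because \<open>l \<ge> 2\<close>.\<close>

lemma sum_inverse_log_window_ge:
  assumes l: "l \<ge> 2"
  shows "(\<Sum>n\<in>log_window y (1/l). 1 / real n) \<ge> 1 / l - exp (-y)"
proof -
  define A B where "A = exp (y - 1/l)" and "B = exp (y + 1/l)"
  have pos: "A > 0" "B > 0" by (auto simp: A_def B_def)
  have "{nat \<lceil>A\<rceil>..nat \<lfloor>B\<rfloor>} \<subseteq> log_window y (1/l)"
  proof
    fix n assume n: "n \<in> {nat \<lceil>A\<rceil>..nat \<lfloor>B\<rfloor>}"
    then have "A \<le> real n" "real n \<le> B" using pos by (auto simp: le_nat_iff nat_le_iff le_floor_iff ceiling_le_iff)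
    moreover from this have "real n > 0" using pos by linarith
    ultimately have "real n > 0" "y - 1/l \<le> ln (real n)" "ln (real n) \<le> y + 1/l"
      using pos ln_le_cancel_iff[of A "real n"] ln_le_cancel_iff[of "real n" B] by (auto simp: A_def B_def)
    then show "n \<in> log_window y (1/l)" by (auto simp: log_window_def abs_le_iff)
  qed
  then have "card {nat \<lceil>A\<rceil>..nat \<lfloor>B\<rfloor>} \<le> card (log_window y (1/l))"
    by (intro card_mono) auto
  then have "real (nat \<lfloor>B\<rfloor>) + 1 - real (nat \<lceil>A\<rceil>) \<le> real (card (log_window y (1/l)))"
    by simp
  moreover have "real (nat \<lfloor>B\<rfloor>) > B - 1" "real (nat \<lceil>A\<rceil>) < A + 1"
    using pos by (auto simp: of_nat_nat ceiling_less_iff intro: order_less_le_trans) linarith+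
  ultimately have card: "B - A - 1 \<le> real (card (log_window y (1/l)))" by linarith
  have "1 / l \<le> 1 - A / B"
  proof -
    have "exp (2 / l) \<ge> 1 + 2 / l" by (rule exp_ge_add_one_self)
    then have "inverse (exp (2 / l)) \<le> inverse (1 + 2 / l)"
      using l by (intro le_imp_inverse_le) (auto intro: add_pos_nonneg)
    moreover have "A / B = inverse (exp (2 / l))"
      unfolding A_def B_def by (simp flip: exp_diff exp_minus)
    moreover have "inverse (1 + 2 / l) \<le> 1 - 1 / l" using l by (simp add: field_simps)
    ultimately show ?thesis by linarith
  qed
  moreover have "1 / B \<le> exp (-y)"
    using l by (simp add: B_def exp_minus field_simps exp_add)
  ultimately have "1 / l - exp (-y) \<le> (B - A - 1) / B"
    using pos by (simp add: diff_divide_distrib)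
  also have "\<dots> \<le> real (card (log_window y (1/l))) / B"
    using card pos by (intro divide_right_mono) auto
  also have "\<dots> = (\<Sum>n\<in>log_window y (1/l). 1 / B)" by simp
  also have "\<dots> \<le> (\<Sum>n\<in>log_window y (1/l). 1 / real n)"
    using log_window_le[of _ y "1/l"] pos
    by (intro sum_mono divide_left_mono) (auto simp: B_def log_window_def)
  finally show ?thesis .
qed

theorem mangoldt_window_lower_bound:
  assumes e: "0 < e" "e \<le> 1"
  obtains c where "c > 0" "\<forall>\<^sub>F y in at_top. (\<Sum>n\<in>log_window y e. mangoldt n / real n) \<ge> c"
proof -
  obtain C where C: "\<And>y. (\<Sum>n\<in>log_window y (1/2). mangoldt n / real n) \<le> C"
    using mangoldt_window_bound by blast
  \<comment> \<open>Narrows the kernel until its mass outside the window of radius \<open>e\<close>,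
    at most \<open>60 * C / (l * e\<^sup>2)\<close>, falls below 1/32. Here
    \<open>60 = 4 * 15\<close> joins \<open>fejer_tail_le\<close> and
    \<open>sum_weighted_le\<close>.\<close>
  define l where "l = max 2 (60 * C * 32 / e\<^sup>2)"
  have l2: "l \<ge> 2" and l: "l > 0" by (auto simp: l_def)
  have tail: "60 * C / (l * e\<^sup>2) \<le> 1 / 32"
  proof -
    have "60 * C * 32 / e\<^sup>2 \<le> l" by (simp add: l_def)
    then have "60 * C * 32 \<le> l * e\<^sup>2" using e by (simp add: field_simps)
    then show ?thesis using l e by (simp add: field_simps)
  qed
  obtain d Y where d: "d > 0" "\<And>a y. 1 < a \<Longrightarrow> a \<le> 1 + d \<Longrightarrow> y \<ge> Y \<Longrightarrow> \<bar>mangoldt_fejer_diff l a y\<bar> \<le> 1/32"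
    using mangoldt_fejer_diff_small[OF l, of "1/32"] by auto
  \<comment> \<open>The kernel is at least \<open>l / 4\<close> on the radius \<open>1 / l\<close>
    and at most \<open>l / 2\<close> everywhere. One error 1/32 is the difference of the averages,
    the other is the tail. Both sides are finite sums, so the inequality passes to the limit
    \<open>a = 1\<close>.\<close>
  have main: "(\<Sum>n\<in>log_window y (1/l). 1 / real n) * (l / 4) - 1/32 \<le>
      (\<Sum>n\<in>log_window y e. mangoldt n / real n) * (l / 2) + 1/32" if y: "y \<ge> Y" for y
  proof (rule tendsto_le[where F = "at_right 1"])
    show "((\<lambda>a. (\<Sum>n\<in>log_window y (1/l). 1 * real n powr (-a)) * (l / 4) - 1/32) \<longlongrightarrow>
        (\<Sum>n\<in>log_window y (1/l). 1 / real n) * (l / 4) - 1/32) (at_right 1)"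
      by (intro tendsto_diff tendsto_mult tendsto_const sum_powr_tendsto)
    show "((\<lambda>a. (\<Sum>n\<in>log_window y e. mangoldt n * real n powr (-a)) * (l / 2) + 1/32) \<longlongrightarrow>
        (\<Sum>n\<in>log_window y e. mangoldt n / real n) * (l / 2) + 1/32) (at_right 1)"
      by (intro tendsto_add tendsto_mult tendsto_const sum_powr_tendsto)
    have "\<forall>\<^sub>F a in at_right (1::real). a \<in> {1<..<1+d}"
      using d(1) by (intro eventually_at_right_field[THEN iffD2] exI[of _ "1+d"]) auto
    then show "\<forall>\<^sub>F a in at_right 1. (\<Sum>n\<in>log_window y (1/l). 1 * real n powr (-a)) * (l / 4) - 1/32
        \<le> (\<Sum>n\<in>log_window y e. mangoldt n * real n powr (-a)) * (l / 2) + 1/32"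
    proof eventually_elim
      case (elim a)
      then have a: "a > 1" by auto
      let ?f = "\<lambda>n. mangoldt n * real n powr (-a) * fejer l (y - ln (real n))"
      let ?g = "\<lambda>n. real n powr (-a) * fejer l (y - ln (real n))"
      have sf: "summable ?f"
        using a by (intro summable_powr_fejer l mangoldt_nonneg summable_mangoldt_powr) auto
      have sg: "summable ?g"
        using a summable_powr_fejer[OF l, of "\<lambda>_. 1" a y] summable_nat_powr[of a] by simp
      have nonneg: "?f n \<ge> 0" "?g n \<ge> 0" for n
        by (auto intro!: mult_nonneg_nonneg mangoldt_nonneg fejer_nonneg l)
      have "suminf ?f \<le> (\<Sum>n\<in>log_window y e. ?f n) + 60 * C / (l * e\<^sup>2)"
      proof (rule suminf_le_of_finite_sums[OF sf])
        fix A :: "nat set" assume A: "finite A" "0 \<notin> A"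
        have "sum ?f A = sum ?f (A \<inter> log_window y e) + sum ?f (A - log_window y e)"
          using A by (subst sum.union_disjoint[symmetric]) (auto intro: sum.cong)
        also have "sum ?f (A \<inter> log_window y e) \<le> sum ?f (log_window y e)"
          using nonneg by (intro sum_mono2) auto
        also have "sum ?f (A - log_window y e) \<le>
           (\<Sum>n\<in>A - log_window y e. 4 / (l * e\<^sup>2) * (mangoldt n / real n / (1 + (y - ln (real n))\<^sup>2)))"
        proof (rule sum_mono)
          fix n assume n: "n \<in> A - log_window y e"
          then have "n > 0" using A(2) by (auto intro: Nat.gr0I)
          then have "\<bar>y - ln (real n)\<bar> \<ge> e" using n by (auto simp: log_window_def)
          then have f: "fejer l (y - ln (real n)) \<le> 4 / (l * e\<^sup>2) / (1 + (y - ln (real n))\<^sup>2)"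
            by (rule fejer_tail_le[OF l e])
          have m: "mangoldt n * real n powr (-a) \<le> mangoldt n * (1 / real n)"
            using a by (intro mult_left_mono nat_powr_minus_le mangoldt_nonneg) auto
          have "?f n \<le> mangoldt n * (1 / real n) * (4 / (l * e\<^sup>2) / (1 + (y - ln (real n))\<^sup>2))"
            by (intro mult_mono[OF m f] fejer_nonneg l mult_nonneg_nonneg mangoldt_nonneg) auto
          then show "?f n \<le> 4 / (l * e\<^sup>2) * (mangoldt n / real n / (1 + (y - ln (real n))\<^sup>2))"
            by (simp add: mult_ac)
        qed
        also have "\<dots> = 4 / (l * e\<^sup>2) * (\<Sum>n\<in>A - log_window y e. mangoldt n / real n / (1 + (y - ln (real n))\<^sup>2))"
          by (simp add: sum_distrib_left)
        also have "\<dots> \<le> 4 / (l * e\<^sup>2) * (15 * C)"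
          using A l by (intro mult_left_mono sum_weighted_le C) (auto intro!: divide_nonneg_nonneg mangoldt_nonneg)
        finally show "sum ?f A \<le> (\<Sum>n\<in>log_window y e. ?f n) + 60 * C / (l * e\<^sup>2)" by simp
      qed auto
      also have "(\<Sum>n\<in>log_window y e. ?f n) \<le> (\<Sum>n\<in>log_window y e. mangoldt n * real n powr (-a) * (l / 2))"
        by (intro sum_mono mult_left_mono fejer_le_half l mult_nonneg_nonneg mangoldt_nonneg) auto
      also have "\<dots> = (\<Sum>n\<in>log_window y e. mangoldt n * real n powr (-a)) * (l / 2)"
        by (simp only: sum_distrib_right)
      finally have f: "suminf ?f \<le> (\<Sum>n\<in>log_window y e. mangoldt n * real n powr (-a)) * (l / 2) + 1/32"
        using tail by linarith
      have "(\<Sum>n\<in>log_window y (1/l). 1 * real n powr (-a)) * (l / 4) =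
          (\<Sum>n\<in>log_window y (1/l). real n powr (-a) * (l / 4))"
        by (simp only: sum_distrib_right mult_1_left)
      also have "\<dots> \<le> (\<Sum>n\<in>log_window y (1/l). ?g n)"
      proof (intro sum_mono mult_left_mono)
        fix n assume "n \<in> log_window y (1/l)"
        then show "l / 4 \<le> fejer l (y - ln (real n))"
          using l by (intro fejer_ge) (auto simp: log_window_def field_simps)
      qed auto
      also have "\<dots> \<le> suminf ?g"
        using sg nonneg by (intro sum_le_suminf) auto
      also have "suminf ?g \<le> suminf ?f + 1/32"
        using abs_le_D2[OF d(2)[of a y]] elim y mangoldt_fejer_diff_split[OF l a, of y] by simp
      also note f
      finally show ?case by linarith
    qed
  qed auto
  show ?thesis
  \<comment> \<open>For large \<open>y\<close> the left side of \<open>main\<close> is at least 1/8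
    - 1/32, so \<open>l / 2\<close> times the window sum is at least 1/32.\<close>
  proof (rule that[of "1 / (16 * l)"])
    have "((\<lambda>y. l * exp (-y) / 4) \<longlongrightarrow> 0) at_top" by real_asymp
    then have "\<forall>\<^sub>F y in at_top. l * exp (-y) / 4 < 1/8"
      by (rule order_tendstoD) auto
    then show "\<forall>\<^sub>F y in at_top. 1 / (16 * l) \<le> (\<Sum>n\<in>log_window y e. mangoldt n / real n)"
      using eventually_ge_at_top[of Y]
    proof eventually_elim
      case (elim y)
      have "(1 / l - exp (-y)) * (l / 4) \<le> (\<Sum>n\<in>log_window y (1/l). 1 / real n) * (l / 4)"
        using l2 by (intro mult_right_mono sum_inverse_log_window_ge) auto
      moreover have "(1 / l - exp (-y)) * (l / 4) = 1/4 - l * exp (-y) / 4"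
        using l by (simp add: field_simps)
      ultimately have "1/32 \<le> (\<Sum>n\<in>log_window y e. mangoldt n / real n) * (l / 2)"
        using main[OF elim(2)] elim(1) by linarith
      then show ?case using l by (simp add: field_simps)
    qed
  qed (use l in auto)
qed

text \<open>Only prime powers \<open>p ^ k\<close> with \<open>k \<ge> 2\<close> contribute. Then
  \<open>p\<close> is at most the square root of \<open>exp (y + 1)\<close> and \<open>k\<close> at
  most logarithmic, so the first two factors count the pairs; the third bounds a single
  term.\<close>

lemma sum_nonprime_log_window_le:
  assumes e: "0 \<le> e" "e \<le> 1" and y: "y \<ge> 0"
  shows "(\<Sum>n | n \<in> log_window y e \<and> \<not> prime n. mangoldt n / real n) \<le>
    (exp ((y + 1) / 2) + 1) * ((y + 1) / ln 2 + 1) * ((y + 1) / exp (y - 1))"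
proof -
  let ?W = "{n. n \<in> log_window y e \<and> \<not> prime n}"
  define Q where "Q = {n. n \<in> log_window y e \<and> \<not> prime n \<and> primepow n}"
  define P K where "P = nat \<lfloor>exp ((y + 1) / 2)\<rfloor>" and "K = nat \<lfloor>(y + 1) / ln 2\<rfloor>"
  have Q: "Q \<subseteq> log_window y e" by (auto simp: Q_def)
  have upper: "real n \<le> exp (y + 1)" "ln (real n) \<le> y + 1" "n > 0" "real n \<ge> exp (y - 1)"
    if "n \<in> Q" for n
  proof -
    have n: "n \<in> log_window y e" using that Q by blast
    show "n > 0" "ln (real n) \<le> y + 1" using n e by (auto simp: log_window_def)
    have "exp (y + e) \<le> exp (y + 1)" "exp (y - 1) \<le> exp (y - e)" using e by auto
    then show "real n \<le> exp (y + 1)" "real n \<ge> exp (y - 1)"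
      using log_window_le[OF n] log_window_ge[OF n] by linarith+
  qed
  have "Q \<subseteq> (\<lambda>(p, k). p ^ k) ` ({..P} \<times> {..K})"
  proof
    fix n assume n: "n \<in> Q"
    then obtain p k where pk: "prime p" "k > 0" "n = p ^ k"
      by (auto simp: Q_def primepow_def)
    have "k \<noteq> 1" using n pk by (auto simp: Q_def)
    with pk have k: "k \<ge> 2" by simp
    have p: "p \<ge> 2" using pk(1) by (rule prime_ge_2_nat)
    have "p ^ 2 \<le> n" using k p unfolding pk(3) by (intro power_increasing) auto
    then have "(real p)\<^sup>2 \<le> real n" by (metis of_nat_le_iff of_nat_power)
    also have "\<dots> \<le> exp (y + 1)" by (rule upper(1)[OF n])
    also have "\<dots> = (exp ((y + 1) / 2))\<^sup>2"
      by (simp add: power2_eq_square flip: exp_add)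
    finally have "real p \<le> exp ((y + 1) / 2)" by (rule power2_le_imp_le) auto
    then have "p \<le> P" unfolding P_def by (rule le_nat_floor)
    have "real k * ln 2 \<le> real k * ln (real p)"
      using p by (intro mult_left_mono) auto
    also have "\<dots> = ln (real n)" using p by (simp add: pk(3) ln_realpow)
    also have "\<dots> \<le> y + 1" using upper[OF n] by simp
    finally have "real k \<le> (y + 1) / ln 2" by (simp add: field_simps)
    then have "k \<le> K" unfolding K_def by (rule le_nat_floor)
    with \<open>p \<le> P\<close> show "n \<in> (\<lambda>(p, k). p ^ k) ` ({..P} \<times> {..K})" using pk(3) by auto
  qed
  then have "card Q \<le> card ({..P} \<times> {..K})"
    by (intro surj_card_le) auto
  then have "card Q \<le> (P + 1) * (K + 1)" by simp
  then have "real (card Q) \<le> real ((P + 1) * (K + 1))" by (rule of_nat_mono)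
  also have "\<dots> = (real P + 1) * (real K + 1)" by (simp add: algebra_simps)
  also have "\<dots> \<le> (exp ((y + 1) / 2) + 1) * ((y + 1) / ln 2 + 1)"
    unfolding P_def K_def using y by (intro mult_mono add_mono of_nat_floor) auto
  finally have card: "real (card Q) \<le> (exp ((y + 1) / 2) + 1) * ((y + 1) / ln 2 + 1)" .
  have "(\<Sum>n\<in>?W. mangoldt n / real n) = (\<Sum>n\<in>Q. mangoldt n / real n)"
    by (rule sum.mono_neutral_right) (auto simp: Q_def mangoldt_def intro: finite_subset[OF _ finite_log_window])
  also have "\<dots> \<le> (\<Sum>n\<in>Q. (y + 1) / exp (y - 1))"
  proof (rule sum_mono)
    fix n assume n: "n \<in> Q"
    have "mangoldt n \<le> y + 1" using mangoldt_le[of n] upper[OF n] by simp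
    then show "mangoldt n / real n \<le> (y + 1) / exp (y - 1)"
      using upper[OF n] y by (intro frac_le) auto
  qed
  also have "\<dots> = real (card Q) * ((y + 1) / exp (y - 1))" by simp
  also have "\<dots> \<le> (exp ((y + 1) / 2) + 1) * ((y + 1) / ln 2 + 1) * ((y + 1) / exp (y - 1))"
    using card y by (intro mult_right_mono) auto
  finally show ?thesis .
qed

theorem eventually_prime_in_log_window:
  assumes e: "0 < e" "e \<le> 1"
  shows "\<forall>\<^sub>F y in at_top. \<exists>p. prime p \<and> p \<in> log_window y e"
proof -
  obtain c where c: "c > 0" "\<forall>\<^sub>F y in at_top. (\<Sum>n\<in>log_window y e. mangoldt n / real n) \<ge> c"
    using mangoldt_window_lower_bound[OF e] by blast
  have "((\<lambda>y::real. (exp ((y + 1) / 2) + 1) * ((y + 1) / ln 2 + 1) * ((y + 1) / exp (y - 1))) \<longlongrightarrow> 0) at_top"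
    by real_asymp
  then have "\<forall>\<^sub>F y in at_top. (exp ((y + 1) / 2) + 1) * ((y + 1) / ln 2 + 1) * ((y + 1) / exp (y - 1)) < c"
    using c(1) by (rule order_tendstoD)
  then show ?thesis
    using c(2) eventually_ge_at_top[of "0::real"]
  proof eventually_elim
    case (elim y)
    show ?case
    proof (rule ccontr)
      assume "\<not> ?thesis"
      then have "log_window y e = {n. n \<in> log_window y e \<and> \<not> prime n}" by auto
      then have "(\<Sum>n\<in>log_window y e. mangoldt n / real n) < c"
        using sum_nonprime_log_window_le[of e y] elim(1,3) e by simp
      with elim(2) show False by linarith
    qed
  qed
qed

section \<open>Sidon sets\<close>

text \<open>The difference equation is written additively, with \<open>a \<noteq> b\<close> standing
  for \<open>x \<noteq> 0\<close>. Equality of the first components suffices, since the second ones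
  then agree too.\<close>

lemma sidonI:
  assumes "\<And>a b c d. a \<in> S \<Longrightarrow> b \<in> S \<Longrightarrow> c \<in> S \<Longrightarrow> d \<in> S \<Longrightarrow> a + d = c + b \<Longrightarrow> a \<noteq> b \<Longrightarrow> a = c"
  shows "sidon S"
  unfolding sidon_def Uniq_def
proof (intro allI impI)
  fix x :: int and p q
  assume x: "x \<noteq> 0" "p \<in> S \<times> S \<and> x = fst p - snd p" "q \<in> S \<times> S \<and> x = fst q - snd q"
  then have "fst p = fst q"
    by (intro assms[of "fst p" "snd p" "fst q" "snd q"]) auto
  with x show "p = q" by (auto simp: prod_eq_iff)
qed

lemma sidonD:
  assumes "sidon S" "a \<in> S" "b \<in> S" "c \<in> S" "d \<in> S" "a - b = c - d" "a \<noteq> b"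
  shows "a = c"
  using assms Uniq_D[of "\<lambda>p. p \<in> S \<times> S \<and> a - b = fst p - snd p" "(a, b)" "(c, d)"]
  unfolding sidon_def by auto

text \<open>Ruzsa's construction: the residue \<open>x i\<close> modulo \<open>p (p - 1)\<close> with \<open>x i \<equiv> i\<close> modulo \<open>p - 1\<close>
  and \<open>x i \<equiv> g\<^sup>i\<close> modulo \<open>p\<close>. A sum \<open>x i + x j\<close> determines both the product and the sum
  of \<open>g\<^sup>i\<close> and \<open>g\<^sup>j\<close> modulo \<open>p\<close>, hence the pair.\<close>
theorem Ruzsa_sidon_set:
  fixes p :: nat
  assumes p: "prime p"
  obtains S :: "int set" where "S \<subseteq> {1..int (p * (p - 1))}" "sidon S" "card S = p - 1"
proof -
  have p2: "p \<ge> 2" using p by (rule prime_ge_2_nat)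
  obtain g where "residue_primroot p g" using prime_primitive_root_exists[OF _ p] p2 by auto
  then have g: "coprime p g" "ord p g = p - 1"
    using p by (auto simp: residue_primroot_def totient_prime)
  have pow_cong: "[g ^ i = g ^ k] (mod p) \<longleftrightarrow> [i = k] (mod (p - 1))" for i k
    using order_divides_expdiff[OF g(1)] g(2) by simp
  have "coprime (p - 1) p"
    using p2 coprime_diff_one_left_nat[of p] by simp
  then have "\<exists>x. x < (p - 1) * p \<and> [x = i] (mod (p - 1)) \<and> [x = g ^ i] (mod p)" for i
    using binary_chinese_remainder_unique_nat[of "p - 1" p i "g ^ i"] p2 by auto
  then obtain x where x: "\<And>i. x i < (p - 1) * p" "\<And>i. [x i = i] (mod (p - 1))"
      "\<And>i. [x i = g ^ i] (mod p)"
    by metis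
  have index_eq: "i = k" if "[i = k] (mod (p - 1))" "i < p - 1" "k < p - 1" for i k
    using that by (simp add: cong_def)
  \<comment> \<open>Powers of \<open>g\<close> are units modulo \<open>p\<close>, so no residue is
    0; thus the representatives start at 1 without a shift.\<close>
  have x_pos: "x i > 0" for i
  proof (rule Nat.gr0I)
    assume "x i = 0"
    with x(3)[of i] have "p dvd g ^ i" by (metis cong_0_iff cong_sym)
    then have "p dvd g" using p by (rule prime_dvd_power[rotated])
    with g(1) p2 show False using coprime_common_divisor_nat[of p g p] by simp
  qed
  have inj: "inj_on x {..<p - 1}"
  proof (rule inj_onI)
    fix i k assume ik: "i \<in> {..<p - 1}" "k \<in> {..<p - 1}" "x i = x k"
    then have "[i = k] (mod (p - 1))" using x(2)[of i] x(2)[of k] by (metis cong_sym cong_trans)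
    then show "i = k" using ik by (intro index_eq) auto
  qed
  have key: "x i = x k" if "i < p - 1" "j < p - 1" "k < p - 1" "x i + x m = x k + x j" "i \<noteq> j" for i j k m
  proof -
    have "[i + m = k + j] (mod (p - 1))"
      using cong_add[OF x(2)[of i] x(2)[of m]] cong_add[OF x(2)[of k] x(2)[of j]] that(4)
      by (metis cong_sym cong_trans)
    then have "[g ^ i * g ^ m = g ^ k * g ^ j] (mod p)"
      by (simp add: pow_cong flip: power_add)
    then have mult: "int p dvd int g ^ i * int g ^ m - int g ^ k * int g ^ j"
      by (simp add: cong_iff_dvd_diff flip: cong_int_iff)
    have "[g ^ i + g ^ m = g ^ k + g ^ j] (mod p)"
      using cong_add[OF x(3)[of i] x(3)[of m]] cong_add[OF x(3)[of k] x(3)[of j]] that(4)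
      by (metis cong_sym cong_trans)
    then have add: "int p dvd (int g ^ i + int g ^ m) - (int g ^ k + int g ^ j)"
      by (simp add: cong_iff_dvd_diff flip: cong_int_iff)
    \<comment> \<open>Equal sum and product modulo \<open>p\<close> make \<open>g ^ i\<close> a root
      of the quadratic with roots \<open>g ^ k\<close> and \<open>g ^ j\<close>. As \<open>p\<close>
      is prime, one factor vanishes modulo \<open>p\<close>, and \<open>i \<noteq> j\<close>
      excludes the second.\<close>
    have "(int g ^ i - int g ^ k) * (int g ^ i - int g ^ j) =
        int g ^ i * ((int g ^ i + int g ^ m) - (int g ^ k + int g ^ j))
        - (int g ^ i * int g ^ m - int g ^ k * int g ^ j)"
      by (simp add: algebra_simps)
    also have "int p dvd \<dots>" by (rule dvd_diff[OF dvd_mult[OF add] mult])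
    finally have "int p dvd (int g ^ i - int g ^ k) * (int g ^ i - int g ^ j)" .
    then have "int p dvd int g ^ i - int g ^ k \<or> int p dvd int g ^ i - int g ^ j"
      using p by (simp add: prime_dvd_mult_iff)
    then have "[g ^ i = g ^ k] (mod p) \<or> [g ^ i = g ^ j] (mod p)"
      by (simp add: cong_iff_dvd_diff flip: cong_int_iff)
    then have "i = k \<or> i = j" using that index_eq unfolding pow_cong by blast
    then show ?thesis using that(5) by blast
  qed
  show ?thesis
  proof (rule that[of "(\<lambda>i. int (x i)) ` {..<p - 1}"])
    show "(\<lambda>i. int (x i)) ` {..<p - 1} \<subseteq> {1..int (p * (p - 1))}"
    proof
      fix z assume "z \<in> (\<lambda>i. int (x i)) ` {..<p - 1}"
      then obtain i where z: "z = int (x i)" by blast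
      have "x i \<le> p * (p - 1)" using x(1)[of i] by (simp add: mult.commute)
      then have "z \<le> int (p * (p - 1))" unfolding z by (rule of_nat_mono)
      moreover have "z \<ge> 1" using x_pos[of i] z by simp
      ultimately show "z \<in> {1..int (p * (p - 1))}" unfolding atLeastAtMost_iff by blast
    qed
    show "card ((\<lambda>i. int (x i)) ` {..<p - 1}) = p - 1"
      using inj by (subst card_image) (auto simp: inj_on_def)
    show "sidon ((\<lambda>i. int (x i)) ` {..<p - 1})"
    proof (rule sidonI, elim imageE)
      fix a b c d i j k m
      assume *: "a = int (x i)" "b = int (x j)" "c = int (x k)" "d = int (x m)" "a + d = c + b" "a \<noteq> b"
        "i \<in> {..<p - 1}" "j \<in> {..<p - 1}" "k \<in> {..<p - 1}"
      then have "x i + x m = x k + x j" "i \<noteq> j" by (auto simp flip: of_nat_add)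
      then show "a = c" using * key[of i j k m] by auto
    qed
  qed
qed

section \<open>From prime parameters to every \<open>N\<close>\<close>

definition admissible :: "nat \<Rightarrow> int set \<Rightarrow> bool" where
  "admissible N S \<longleftrightarrow> S \<subseteq> {1..int N} \<and> sidon S \<and>
     \<not> (\<exists>x1\<in>S. \<exists>x2\<in>S. \<exists>x3\<in>S. \<exists>x4\<in>S. \<exists>x5\<in>S. x1 + x2 + x3 + x4 = x5)"

lemma admissible_of_prime:
  assumes p: "prime p" and N: "2 * p\<^sup>2 \<le> N"
  obtains S where "admissible N S" "card S = p - 1"
proof -
  obtain S :: "int set" where S: "S \<subseteq> {1..int (p * (p - 1))}" "sidon S" "card S = p - 1"
    using Ruzsa_sidon_set[OF p] by blast
  define T where "T = (\<lambda>z. 2 * z - 1) ` S"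
  have "p * (p - 1) \<le> p\<^sup>2" by (simp add: power2_eq_square)
  then have "2 * (p * (p - 1)) \<le> N" using N by linarith
  then have "2 * int (p * (p - 1)) \<le> int N" by linarith
  moreover have "1 \<le> w" "w \<le> int (p * (p - 1))" if "w \<in> S" for w
    using S(1) that by (auto simp del: of_nat_mult)
  ultimately have 1: "T \<subseteq> {1..int N}" unfolding T_def by fastforce
  have 2: "sidon T"
  proof (rule sidonI)
    fix a b c d assume "a \<in> T" "b \<in> T" "c \<in> T" "d \<in> T" and eq: "a + d = c + b" "a \<noteq> b"
    then obtain a' b' c' d' where *: "a = 2 * a' - 1" "b = 2 * b' - 1" "c = 2 * c' - 1" "d = 2 * d' - 1"
      "a' \<in> S" "b' \<in> S" "c' \<in> S" "d' \<in> S" by (auto simp: T_def)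
    then have "a' = c'" using eq by (intro sidonD[OF S(2), of a' b' c' d']) auto
    then show "a = c" using * by simp
  qed
  have odd: "odd z" if "z \<in> T" for z using that by (auto simp: T_def)
  have 3: "\<not> (\<exists>x1\<in>T. \<exists>x2\<in>T. \<exists>x3\<in>T. \<exists>x4\<in>T. \<exists>x5\<in>T. x1 + x2 + x3 + x4 = x5)"
  proof (intro notI, elim bexE)
    fix x1 x2 x3 x4 x5
    assume "x1 \<in> T" "x2 \<in> T" "x3 \<in> T" "x4 \<in> T" "x5 \<in> T" and eq: "x1 + x2 + x3 + x4 = x5"
    then have "odd x1" "odd x2" "odd x3" "odd x4" "odd x5" using odd by blast+
    then show False unfolding eq[symmetric] by simp
  qed
  have "card T = p - 1"
    unfolding T_def S(3)[symmetric] by (rule card_image) (auto simp: inj_on_def)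
  with 1 2 3 that show ?thesis unfolding admissible_def by blast
qed

lemma eventually_large_admissible:
  assumes d: "d > 0"
  shows "\<forall>\<^sub>F N in sequentially. \<exists>S. admissible N S \<and> real (card S) \<ge> sqrt (real N / 2) * (1 - d)"
proof -
  define e where "e = min 1 (d / 4)"
  \<comment> \<open>The window has ratio \<open>exp (2 * e)\<close> between its ends, and
    \<open>exp (-2 * e) \<ge> 1 - d / 2\<close>. The other \<open>d / 2\<close> absorbs the loss of
    1 in \<open>card S = p - 1\<close>.\<close>
  have e: "0 < e" "e \<le> 1" "e \<le> d / 4" using d by (auto simp: e_def)
  \<comment> \<open>Shifted by \<open>e\<close> so that the upper end of the window is exactly
    \<open>sqrt (real N / 2)\<close>, which turns into \<open>2 * p\<^sup>2 \<le> N\<close>.\<close>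
  define y where "y N = ln (sqrt (real N / 2)) - e" for N :: nat
  have "filterlim (\<lambda>N. ln (sqrt (real N / 2)) - e) at_top sequentially" by real_asymp
  then have "\<forall>\<^sub>F N in sequentially. \<exists>p. prime p \<and> p \<in> log_window (y N) e"
    unfolding y_def by (rule eventually_compose_filterlim[OF eventually_prime_in_log_window[OF e(1,2)]])
  moreover have "filterlim (\<lambda>N. d / 2 * sqrt (real N / 2)) at_top sequentially"
    using d by real_asymp
  then have "\<forall>\<^sub>F N in sequentially. 1 \<le> d / 2 * sqrt (real N / 2)"
    unfolding filterlim_at_top by blast
  ultimately show ?thesis
    using eventually_gt_at_top[of 0]
  proof eventually_elim
    case (elim N)
    define s where "s = sqrt (real N / 2)"
    have s: "s > 0" "s\<^sup>2 = real N / 2" using elim by (auto simp: s_def)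
    obtain p where p: "prime p" "p \<in> log_window (y N) e" using elim by blast
    have "real p \<le> exp (y N + e)" by (rule log_window_le[OF p(2)])
    also have "\<dots> = s" using s(1) by (simp add: y_def s_def)
    finally have "(real p)\<^sup>2 \<le> s\<^sup>2" by (intro power_mono) auto
    then have "real (2 * p\<^sup>2) \<le> real N" using s(2) by simp
    then have "2 * p\<^sup>2 \<le> N" by (simp only: of_nat_le_iff)
    then obtain S where S: "admissible N S" "card S = p - 1"
      using admissible_of_prime[OF p(1)] by blast
    have "s * (1 - d / 2) \<le> s * exp (- 2 * e)"
    proof (rule mult_left_mono)
      show "1 - d / 2 \<le> exp (- 2 * e)" using e(3) exp_ge_add_one_self[of "- 2 * e"] by linarith
    qed (use s in auto)
    also have "s * exp (- 2 * e) = exp (y N - e)"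
    proof -
      have "y N - e = ln s + - 2 * e" by (simp add: y_def s_def)
      then show ?thesis using s(1) by (simp only: exp_add exp_ln)
    qed
    also have "\<dots> \<le> real p" by (rule log_window_ge[OF p(2)])
    also have "real p = real (card S) + 1"
      using S(2) prime_gt_0_nat[OF p(1)] by simp
    finally have "s * (1 - d) \<le> real (card S)"
      using elim(2) by (simp add: algebra_simps s_def)
    with S(1) show ?case unfolding s_def by blast
  qed
qed

theorem proposition1p13:
  shows "\<exists>(S :: nat \<Rightarrow> int set) (\<epsilon> :: nat \<Rightarrow> real).
    \<epsilon> \<in> o(\<lambda>_. 1) \<and>
    (\<forall>N\<ge>1.
      S N \<subseteq> {1..int N} \<and>
      sidon (S N) \<and>
      real (card (S N)) \<ge> 1 / sqrt 2 * sqrt (real N) * (1 + \<epsilon> N) \<and>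
      \<not> (\<exists>x1\<in>S N. \<exists>x2\<in>S N. \<exists>x3\<in>S N. \<exists>x4\<in>S N. \<exists>x5\<in>S N. x1 + x2 + x3 + x4 = x5))"
proof -
  \<comment> \<open>The sets found above depend on \<open>d\<close>. Taking a largest admissible set
    for each \<open>N\<close> gives one family that is at least as good for every \<open>d\<close>,
    without a diagonal choice.\<close>
  have "\<exists>S. admissible N S \<and> (\<forall>T. admissible N T \<longrightarrow> card T \<le> card S)" for N
  proof (rule ex_has_greatest_nat)
    show "admissible N {}" by (auto simp: admissible_def intro: sidonI)
    show "\<forall>T. admissible N T \<longrightarrow> card T < N + 1"
    proof (intro allI impI)
      fix T assume "admissible N T"
      then have "card T \<le> card {1..int N}" by (intro card_mono) (auto simp: admissible_def)
      then show "card T < N + 1" by simp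
    qed
  qed
  then obtain S where S: "\<And>N. admissible N (S N)"
      "\<And>N T. admissible N T \<Longrightarrow> card T \<le> card (S N)"
    by metis
  \<comment> \<open>Capping at 0 makes convergence one-sided: lower bounds on the cardinality
    suffice, and no upper bound for Sidon sets has to be invoked.\<close>
  define \<epsilon> where "\<epsilon> N = min 0 (real (card (S N)) / sqrt (real N / 2) - 1)" for N
  have "\<epsilon> \<longlonglongrightarrow> 0"
  proof (rule tendstoI)
    fix d :: real assume d: "d > 0"
    have "\<forall>\<^sub>F N in sequentially. \<exists>S. admissible N S \<and> real (card S) \<ge> sqrt (real N / 2) * (1 - d / 2)"
      using d by (intro eventually_large_admissible) auto
    then show "\<forall>\<^sub>F N in sequentially. dist (\<epsilon> N) 0 < d"
      using eventually_gt_at_top[of 0]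
    proof eventually_elim
      case (elim N)
      then obtain T where T: "admissible N T" "real (card T) \<ge> sqrt (real N / 2) * (1 - d / 2)" by blast
      have "real (card T) \<le> real (card (S N))" using S(2)[OF T(1)] by simp
      with T(2) have "sqrt (real N / 2) * (1 - d / 2) \<le> real (card (S N))" by linarith
      then have "1 - d / 2 \<le> real (card (S N)) / sqrt (real N / 2)"
        using elim(2) by (subst pos_le_divide_eq) (auto simp: mult.commute)
      then show ?case using d by (auto simp: \<epsilon>_def dist_real_def min_def)
    qed
  qed
  then have "\<epsilon> \<in> o(\<lambda>_. 1)" by (intro smalloI_tendsto) auto
  moreover have "real (card (S N)) \<ge> 1 / sqrt 2 * sqrt (real N) * (1 + \<epsilon> N)" if "N \<ge> 1" for N
  proof -
    have pos: "sqrt (real N / 2) > 0" using that by simp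
    have "1 / sqrt 2 * sqrt (real N) * (1 + \<epsilon> N) = sqrt (real N / 2) * (1 + \<epsilon> N)"
      by (simp add: real_sqrt_divide)
    also have "\<dots> \<le> sqrt (real N / 2) * (real (card (S N)) / sqrt (real N / 2))"
      by (intro mult_left_mono) (auto simp: \<epsilon>_def min_def)
    also have "\<dots> = real (card (S N))" using pos by simp
    finally show ?thesis .
  qed
  ultimately show ?thesis
    using S(1) unfolding admissible_def by (intro exI[of _ S] exI[of _ \<epsilon>]) blast
qed

end
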